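(* Let $T\in\mathcal{CPMM}$ and let $\lambda>1$. The following conditions are equivalent. (i) The map $T$ is conjugate via a continuous increasing onto map $\psi:[0,1]\to[0,1]$ to some map $S\in\mathcal{CPMM}_\lambda$. (ii) For some classical Markov partition $\mathcal P$ for $T$ there is a positive summable $\lambda$-solution $u=(u_i)_{i\in\mathcal P}$ for the transition matrix of $T$ with respect to $\mathcal P$. (iii) For every classical Markov partition $\mathcal P$ for $T$ there is a positive summable $\lambda$-solution $u=(u_i)_{i\in\mathcal P}$ for the transition matrix of $T$ with respect to $\mathcal P$. (iv) For every slack Markov partition $\mathcal Q$ for $T$ there is a positive summable $\lambda$-solution $v=(v_i)_{i\in\mathcal Q}$ for the transition matrix of $T$ with respect to $\mathcal Q$. (v) For some slack Markov partition $\mathcal Q$ for $T$ there is a positive summable $\lambda$-solution $v=(v_i)_{i\in\mathcal Q}$ for the transition matrix of $T$ with respect to $\mathcal Q$.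
   Context: A continuous map on a closed interval is piecewise monotone if the interval splits into finitely many subintervals on each of which the map is monotone. A Markov partition for a continuous map $T:[0,1]\to[0,1]$ is a finite or countably infinite collection $\mathcal P$ of closed nondegenerate subintervals of $[0,1]$ such that: (1) distinct elements of $\mathcal P$ have disjoint interiors and $[0,1]\setminus\bigcup\mathcal P$ is at most countable; (2) $T|_i$ is monotone for each $i\in\mathcal P$ (classical Markov partition), or piecewise monotone for each $i\in\mathcal P$ (slack Markov partition); (3) for all $i,j\in\mathcal P$ and every maximal interval $i'\subset i$ of monotonicity of $T$, if $T(i')\cap j^\circ\ne\emptyset$ then $T(i')\supset j$. $\mathcal{CPMM}$ is the set of continuous maps $T:[0,1]\to[0,1]$ that are topologically mixing (for all nonempty open $U,V$ there is $n$ with $T^m(U)\cap V\neq\emptyset$ for all $m\ge n$), admit a countably infinite Markov partition, and have finite topological entropy $h_{top}(T)<\infty$. $\mathcal{CPMM}_\lambda$ is the set of $S\in\mathcal{CPMM}$ of constant slope $\lambda$, i.e. $|S'(x)|=\lambda$ for all but countably many $x$. Transition matrix of $T$ with respect to $\mathcal P$: $M=(m_{ij})_{i,j\in\mathcal P}$, where $m_{ij}=0$ if $T(i)\not\supset j$, and otherwise $m_{ij}$ is the maximal number of intervals $i_1,\dots,i_\kappa\subset i$ with pairwise disjoint interiors such that each $T|_{i_\ell}$ is monotone and $T(i_\ell)\supset j$ (this number is finite). A $\lambda$-solution for $M$ is a nonzero nonnegative sequence $v=(v_i)_{i\in\mathcal P}$ with $\sum_{j\in\mathcal P}m_{ij}v_j=\lambda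 v_i$ for all $i\in\mathcal P$; it is summable if $v\in\ell^1(\mathcal P)$. *)

theory Defs
  imports "HOL-Analysis.Analysis"
begin

text \<open>
  A map \<open>[0,1] \<rightarrow> [0,1]\<close> is a function on \<open>real\<close> of which only the values on \<open>{0..1}\<close> matter.
\<close>

definition interval_map :: "(real \<Rightarrow> real) \<Rightarrow> bool" where
  "interval_map T \<longleftrightarrow> continuous_on {0..1} T \<and> T ` {0..1} \<subseteq> {0..1}"

definition monotone_map_on :: "(real \<Rightarrow> real) \<Rightarrow> real set \<Rightarrow> bool" where
  "monotone_map_on T K \<longleftrightarrow> mono_on K T \<or> antimono_on K T"

definition piecewise_monotone_on :: "(real \<Rightarrow> real) \<Rightarrow> real set \<Rightarrow> bool" where
  "piecewise_monotone_on T I \<longleftrightarrow> (\<exists>D. D division_of I \<and> (\<forall>K\<in>D. monotone_map_on T K))"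

definition maximal_monotone_interval :: "(real \<Rightarrow> real) \<Rightarrow> real set \<Rightarrow> real set \<Rightarrow> bool" where
  "maximal_monotone_interval T i K \<longleftrightarrow>
     is_interval K \<and> K \<noteq> {} \<and> K \<subseteq> i \<and> monotone_map_on T K \<and>
     (\<forall>L. is_interval L \<and> K \<subseteq> L \<and> L \<subseteq> i \<and> monotone_map_on T L \<longrightarrow> L = K)"

definition markov_collection :: "(real \<Rightarrow> real) \<Rightarrow> real set set \<Rightarrow> bool" where
  "markov_collection T P \<longleftrightarrow>
     countable P \<and>
     (\<forall>i\<in>P. \<exists>a b. 0 \<le> a \<and> a < b \<and> b \<le> 1 \<and> i = {a..b}) \<and>
     pairwise (\<lambda>i j. interior i \<inter> interior j = {}) P \<and>
     countable ({0..1} - \<Union>P) \<and>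
     (\<forall>i\<in>P. \<forall>j\<in>P. \<forall>K. maximal_monotone_interval T i K \<longrightarrow>
        T ` K \<inter> interior j \<noteq> {} \<longrightarrow> j \<subseteq> T ` K)"

definition classical_markov_partition :: "(real \<Rightarrow> real) \<Rightarrow> real set set \<Rightarrow> bool" where
  "classical_markov_partition T P \<longleftrightarrow>
     markov_collection T P \<and> (\<forall>i\<in>P. monotone_map_on T i)"

definition slack_markov_partition :: "(real \<Rightarrow> real) \<Rightarrow> real set set \<Rightarrow> bool" where
  "slack_markov_partition T P \<longleftrightarrow>
     markov_collection T P \<and> (\<forall>i\<in>P. piecewise_monotone_on T i)"

definition topologically_mixing :: "(real \<Rightarrow> real) \<Rightarrow> bool" where
  "topologically_mixing T \<longleftrightarrow>
     (\<forall>U V. openin (top_of_set {0..1}) U \<and> U \<noteq> {} \<and>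
            openin (top_of_set {0..1}) V \<and> V \<noteq> {} \<longrightarrow>
        (\<exists>n. \<forall>m\<ge>n. (T ^^ m) ` U \<inter> V \<noteq> {}))"

text \<open>
  Topological entropy in Bowen's form: the exponential growth rate in \<open>n\<close> of the maximal
  cardinality of an \<open>(n, \<epsilon>)\<close>-separated set, in the limit \<open>\<epsilon> \<rightarrow> 0\<close>. This limit is a supremum
  because the growth rate decreases in \<open>\<epsilon>\<close>. The empty set contributes \<open>ln 0 = 0\<close>, the same
  as a singleton.
\<close>

definition separated_set :: "(real \<Rightarrow> real) \<Rightarrow> nat \<Rightarrow> real \<Rightarrow> real set \<Rightarrow> bool" where
  "separated_set T n \<epsilon> E \<longleftrightarrow>
     finite E \<and> E \<subseteq> {0..1} \<and>
     (\<forall>x\<in>E. \<forall>y\<in>E. x \<noteq> y \<longrightarrow> (\<exists>k<n. dist ((T ^^ k) x) ((T ^^ k) y) > \<epsilon>))"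

definition topological_entropy :: "(real \<Rightarrow> real) \<Rightarrow> ereal" where
  "topological_entropy T =
     (SUP \<epsilon>\<in>{0<..}. limsup (\<lambda>n. SUP E\<in>{E. separated_set T n \<epsilon> E}.
        ereal (ln (real (card E)) / real n)))"

definition CPMM :: "(real \<Rightarrow> real) set" where
  "CPMM = {T. interval_map T \<and> topologically_mixing T \<and>
     (\<exists>P. infinite P \<and> (classical_markov_partition T P \<or> slack_markov_partition T P)) \<and>
     topological_entropy T < \<infinity>}"

definition constant_slope :: "real \<Rightarrow> (real \<Rightarrow> real) \<Rightarrow> bool" where
  "constant_slope lam S \<longleftrightarrow>
     countable {x \<in> {0..1}.
       \<not> (\<exists>D. (S has_real_derivative D) (at x within {0..1}) \<and> \<bar>D\<bar> = lam)}"

definition CPMM_slope :: "real \<Rightarrow> (real \<Rightarrow> real) set" where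
  "CPMM_slope lam = {S \<in> CPMM. constant_slope lam S}"

text \<open>A continuous strictly increasing surjection of \<open>[0,1]\<close> is a homeomorphism.\<close>

definition conjugate_via :: "(real \<Rightarrow> real) \<Rightarrow> (real \<Rightarrow> real) \<Rightarrow> (real \<Rightarrow> real) \<Rightarrow> bool" where
  "conjugate_via \<psi> T S \<longleftrightarrow>
     continuous_on {0..1} \<psi> \<and> strict_mono_on {0..1} \<psi> \<and> \<psi> ` {0..1} = {0..1} \<and>
     (\<forall>x\<in>{0..1}. \<psi> (T x) = S (\<psi> x))"

text \<open>
  \<open>Max\<close> is only meaningful on a finite set; the cardinalities are bounded when \<open>T\<close> is
  continuous and piecewise monotone on \<open>i\<close> and \<open>j\<close> is a nondegenerate interval.
  Then also every \<open>K \<in> F\<close> is nondegenerate, so counting sets is the same as counting the terms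
  of a list of intervals with pairwise disjoint interiors.
\<close>

definition transition_matrix :: "(real \<Rightarrow> real) \<Rightarrow> real set \<Rightarrow> real set \<Rightarrow> nat" where
  "transition_matrix T i j =
     (if j \<subseteq> T ` i then
        Max {card F |F. finite F \<and>
          (\<forall>K\<in>F. is_interval K \<and> K \<subseteq> i \<and> monotone_map_on T K \<and> j \<subseteq> T ` K) \<and>
          pairwise (\<lambda>K L. interior K \<inter> interior L = {}) F}
      else 0)"

definition lambda_solution ::
    "'i set \<Rightarrow> ('i \<Rightarrow> 'i \<Rightarrow> nat) \<Rightarrow> real \<Rightarrow> ('i \<Rightarrow> real) \<Rightarrow> bool" where
  "lambda_solution P m lam v \<longleftrightarrow>
     (\<forall>i\<in>P. 0 \<le> v i) \<and> (\<exists>i\<in>P. v i \<noteq> 0) \<and>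
     (\<forall>i\<in>P. ((\<lambda>j. real (m i j) * v j) has_sum (lam * v i)) P)"

definition positive_summable_solution ::
    "'i set \<Rightarrow> ('i \<Rightarrow> 'i \<Rightarrow> nat) \<Rightarrow> real \<Rightarrow> ('i \<Rightarrow> real) \<Rightarrow> bool" where
  "positive_summable_solution P m lam v \<longleftrightarrow>
     lambda_solution P m lam v \<and> (\<forall>i\<in>P. 0 < v i) \<and> (\<lambda>i. \<bar>v i\<bar>) summable_on P"

end

theory Submission
  imports Defs
begin

text \<open>
  From a conjugacy \<open>\<psi>\<close> to a map of constant slope \<open>\<lambda>\<close> one reads off the \<open>\<lambda>\<close>-solution
  \<open>v\<^sub>i = |\<psi>(i)|\<close>: a maximal monotone interval (lap) \<open>K\<close> of \<open>T\<close> in \<open>i\<close> satisfies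
  \<open>|\<psi>(T K)| = \<lambda> |\<psi>(K)|\<close>, the image \<open>T K\<close> is tiled by partition elements, and the transition
  matrix counts the laps of \<open>i\<close> whose image contains \<open>j\<close>.

  Conversely, the laps of a slack Markov partition form a classical one, to which
  solutions lift by \<open>u\<^sub>K = \<lambda>\<^sup>-\<^sup>1 \<Sum> v\<^sub>j\<close>, the sum being over \<open>j \<subseteq> T K\<close>. For a classical
  partition, the operator that sends a continuous monotone \<open>F\<close> to the function with increments
  \<open>\<plusminus>\<lambda>\<^sup>-\<^sup>1 F \<circ> T\<close> on each \<open>i\<close> preserves the condition \<open>|F(i)| = u\<^sub>i\<close>. This condition determines \<open>F\<close>
  outside the interiors of the partition elements, in particular at the end points of every \<open>i\<close>
  and \<open>T i\<close>, so the operator contracts by \<open>\<lambda>\<^sup>-\<^sup>1\<close>. Its fixed point \<open>F\<close>, normalized, is the conjugacy. It is strictly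
  increasing: if \<open>F\<close> is constant on an interval \<open>J\<close>, then \<open>F \<circ> T\<close> is continuous with countably many
  values on \<open>J\<close>, hence constant, so \<open>F\<close> is constant on every \<open>T\<^sup>n J\<close>, against mixing.
\<close>

subsection \<open>Tilings by intervals\<close>

text \<open>Countable additivity in the form of unordered sums. The index set is embedded into the
  naturals and padded with empty sets, so that additivity over sequences applies; nonnegativity
  makes the resulting series unconditional.\<close>

lemma has_sum_measure_UN:
  assumes "countable I" and X: "\<And>i. i \<in> I \<Longrightarrow> X i \<in> sets M"
    and disj: "disjoint_family_on X I" and fin: "emeasure M (\<Union>i\<in>I. X i) \<noteq> \<infinity>"
  shows "((\<lambda>i. measure M (X i)) has_sum measure M (\<Union>i\<in>I. X i)) I"
proof -
  define N where "N = to_nat_on I ` I"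
  define A where "A n = (if n \<in> N then X (from_nat_into I n) else {})" for n
  have inj: "inj_on (to_nat_on I) I"
    using assms(1) by (rule inj_on_to_nat_on)
  have AI: "A (to_nat_on I i) = X i" if "i \<in> I" for i
    using that assms(1) by (auto simp: A_def N_def)
  have UA: "(\<Union>n. A n) = (\<Union>i\<in>I. X i)"
    using AI by (auto simp: A_def N_def split: if_splits)
  have "(\<lambda>n. measure M (A n)) sums measure M (\<Union>n. A n)"
  proof (rule measure_UNION)
    show "range A \<subseteq> sets M"
      using X AI by (auto simp: A_def N_def)
    show "disjoint_family A"
      unfolding disjoint_family_on_def
    proof (intro ballI impI)
      fix m n :: nat assume "m \<noteq> n"
      show "A m \<inter> A n = {}"
      proof (cases "m \<in> N \<and> n \<in> N")
        case True
        then obtain i j where "i \<in> I" "j \<in> I" "m = to_nat_on I i" "n = to_nat_on I j"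
          by (auto simp: N_def)
        moreover from this have "X i \<inter> X j = {}"
          using \<open>m \<noteq> n\<close> by (intro disjoint_family_onD[OF disj]) auto
        ultimately show ?thesis
          by (simp add: AI)
      qed (auto simp: A_def)
    qed
    show "emeasure M (\<Union>n. A n) \<noteq> \<infinity>"
      using fin UA by simp
  qed
  then have "((\<lambda>n. measure M (A n)) has_sum measure M (\<Union>i\<in>I. X i)) UNIV"
    unfolding UA by (rule sums_nonneg_imp_has_sum) simp
  also have "?this \<longleftrightarrow> ((\<lambda>n. measure M (A n)) has_sum measure M (\<Union>i\<in>I. X i)) N"
    by (rule has_sum_cong_neutral) (auto simp: A_def)
  also have "\<dots> \<longleftrightarrow> ((\<lambda>i. measure M (A (to_nat_on I i))) has_sum measure M (\<Union>i\<in>I. X i)) I"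
    unfolding N_def has_sum_reindex[OF inj] by (simp add: o_def)
  also have "\<dots> \<longleftrightarrow> ?thesis"
    by (rule has_sum_cong) (simp add: AI)
  finally show ?thesis .
qed

text \<open>The part of the Markov partition condition that does not mention the map, relative to
  any set \<open>I\<close>. It is used for \<open>{0..1}\<close>, for the laps inside a partition
  element and for the image of a lap.\<close>

definition interval_tiling :: "real set set \<Rightarrow> real set \<Rightarrow> bool" where
  "interval_tiling P I \<longleftrightarrow>
     countable P \<and> (\<forall>i\<in>P. \<exists>a b. a < b \<and> i = {a..b} \<and> i \<subseteq> I) \<and>
     pairwise (\<lambda>i j. interior i \<inter> interior j = {}) P \<and> countable (I - \<Union>P)"

lemma interval_tilingD:
  assumes "interval_tiling P I"
  shows "countable P" "countable (I - \<Union>P)"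
    "pairwise (\<lambda>i j. interior i \<inter> interior j = {}) P"
  using assms unfolding interval_tiling_def by blast+

lemma interval_tiling_interior:
  "interval_tiling P I \<Longrightarrow> i \<in> P \<Longrightarrow> j \<in> P \<Longrightarrow> i \<noteq> j \<Longrightarrow> interior i \<inter> interior j = {}"
  unfolding interval_tiling_def pairwise_def by blast

lemma interval_tiling_Icc:
  assumes "interval_tiling P {a..b}" "i \<in> P"
  obtains c d where "c < d" "i = {c..d}" "a \<le> c" "d \<le> b"
proof -
  obtain c d where cd: "c < d" "i = {c..d}" "i \<subseteq> {a..b}"
    using assms unfolding interval_tiling_def by blast
  then show ?thesis
    using that[of c d] by simp
qed

text \<open>For continuous increasing \<open>F\<close> this is the Stieltjes mass of
  \<open>i\<close>, the length of the image of \<open>i\<close> under \<open>F\<close>. Solutions of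
  the transition matrix are read as such masses.\<close>

definition increment :: "(real \<Rightarrow> real) \<Rightarrow> real set \<Rightarrow> real" where
  "increment F i = F (Sup i) - F (Inf i)"

lemma increment_Icc [simp]: "a \<le> b \<Longrightarrow> increment F {a..b} = F b - F a"
  by (simp add: increment_def)

lemma interior_disjoint_Icc:
  fixes a b c d :: real
  assumes "interior {a..b} \<inter> interior {c..d} = {}" "a < b" "c < d"
  shows "b \<le> c \<or> d \<le> a"
proof (rule ccontr)
  assume "\<not> ?thesis"
  then have "(max a c + min b d) / 2 \<in> interior {a..b} \<inter> interior {c..d}"
    using assms(2,3) by (auto simp: max_def min_def)
  with assms(1) show False by blast
qed

text \<open>By the intermediate value theorem the images of the tiles cover
  \<open>{F c..F d}\<close> up to the image of the countable residue. Countable sets are Lebesgue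
  null, so the lengths of the images add up.\<close>

lemma increment_has_sum:
  assumes P: "interval_tiling P {c..d}" and "c \<le> d"
    and cont: "continuous_on {c..d} F" and mono: "mono_on {c..d} F"
  shows "(increment F has_sum (F d - F c)) P"
proof -
  have cP: "countable P"
    using P by (rule interval_tilingD)
  have ab: "\<exists>a b. a < b \<and> i = {a..b} \<and> c \<le> a \<and> b \<le> d" if "i \<in> P" for i
    using P that by (auto elim: interval_tiling_Icc)
  \<comment> \<open>Open intervals are taken because images of adjacent tiles may share end points.
    If \<open>F\<close> is constant on a tile, its \<open>X i\<close> is empty and contributes
    length zero.\<close>
  define X where "X i = {F (Inf i)<..<F (Sup i)}" for i
  have le: "F (Inf i) \<le> F (Sup i)" if "i \<in> P" for i
    using ab[OF that] mono by (auto intro!: mono_onD[OF mono])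
  have disj: "disjoint_family_on X P"
    unfolding disjoint_family_on_def
  proof (intro ballI impI)
    fix i j assume ij: "i \<in> P" "j \<in> P" "i \<noteq> j"
    obtain a b where i: "i = {a..b}" "a < b" "c \<le> a" "b \<le> d" using ab ij by blast
    obtain a' b' where j: "j = {a'..b'}" "a' < b'" "c \<le> a'" "b' \<le> d" using ab ij by blast
    have "interior i \<inter> interior j = {}"
      using P ij by (intro interval_tiling_interior)
    then have "b \<le> a' \<or> b' \<le> a"
      using i j interior_disjoint_Icc by blast
    then have "F b \<le> F a' \<or> F b' \<le> F a"
      using i j by (auto intro!: mono_onD[OF mono])
    then show "X i \<inter> X j = {}"
      using i j by (auto simp: X_def)
  qed
  have sub: "(\<Union>i\<in>P. X i) \<subseteq> {F c..F d}"
  proof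
    fix y assume "y \<in> (\<Union>i\<in>P. X i)"
    then obtain i where i: "i \<in> P" "y \<in> X i" by blast
    obtain a b where "i = {a..b}" "a < b" "c \<le> a" "b \<le> d" using ab i(1) by blast
    moreover from this have "F c \<le> F a" "F b \<le> F d"
      by (auto intro!: mono_onD[OF mono])
    ultimately show "y \<in> {F c..F d}" using i(2) by (auto simp: X_def)
  qed
  have "{F c..F d} - (\<Union>i\<in>P. X i) \<subseteq> F ` ({c..d} - \<Union>P) \<union> (\<Union>i\<in>P. {F (Inf i), F (Sup i)})"
  proof
    fix y assume y: "y \<in> {F c..F d} - (\<Union>i\<in>P. X i)"
    then obtain x where x: "c \<le> x" "x \<le> d" "F x = y"
      using IVT'[of F c y d] cont \<open>c \<le> d\<close> by auto
    show "y \<in> F ` ({c..d} - \<Union>P) \<union> (\<Union>i\<in>P. {F (Inf i), F (Sup i)})"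
    proof (cases "x \<in> \<Union>P")
      case True
      then obtain i where i: "i \<in> P" "x \<in> i" by blast
      obtain a b where "i = {a..b}" "a < b" "c \<le> a" "b \<le> d" using ab i(1) by blast
      moreover from this have "F a \<le> y" "y \<le> F b"
        using i(2) x by (auto intro!: mono_onD[OF mono])
      ultimately show ?thesis using i y by (force simp: X_def)
    qed (use x in auto)
  qed
  moreover have "countable \<dots>"
    using interval_tilingD[OF P] by auto
  ultimately have null: "{F c..F d} - (\<Union>i\<in>P. X i) \<in> null_sets lborel"
    by (meson countable_imp_null_set_lborel countable_subset)
  have sets: "(\<Union>i\<in>P. X i) \<in> sets lborel"
    using cP by (auto simp: X_def)
  have "F c \<le> F d"
    using \<open>c \<le> d\<close> by (auto intro!: mono_onD[OF mono])
  have "emeasure lborel ({F c..F d} - ({F c..F d} - (\<Union>i\<in>P. X i))) = emeasure lborel {F c..F d}"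
    using null by (rule emeasure_Diff_null_set) simp
  also have "{F c..F d} - ({F c..F d} - (\<Union>i\<in>P. X i)) = (\<Union>i\<in>P. X i)"
    using sub by blast
  finally have em: "emeasure lborel (\<Union>i\<in>P. X i) = ennreal (F d - F c)"
    using \<open>F c \<le> F d\<close> by simp
  have "((\<lambda>i. measure lborel (X i)) has_sum measure lborel (\<Union>i\<in>P. X i)) P"
    by (rule has_sum_measure_UN[OF cP _ disj]) (simp_all add: em, simp add: X_def)
  also have "measure lborel (\<Union>i\<in>P. X i) = F d - F c"
    using em \<open>F c \<le> F d\<close> by (simp add: measure_def)
  also have "((\<lambda>i. measure lborel (X i)) has_sum (F d - F c)) P \<longleftrightarrow> ?thesis"
    by (rule has_sum_cong) (use le in \<open>simp add: X_def increment_def\<close>)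
  finally show ?thesis .
qed

text \<open>A tile that meets \<open>{c..d}\<close> in a point other than \<open>c\<close> and
  \<open>d\<close> without lying inside it has \<open>c\<close> or \<open>d\<close> in its interior.
  So discarding the tiles that stick out uncovers at most \<open>c\<close> and
  \<open>d\<close>.\<close>

lemma interval_tiling_subset:
  assumes P: "interval_tiling P {a..b}" and "a \<le> c" "c \<le> d" "d \<le> b"
    and c: "\<And>j. j \<in> P \<Longrightarrow> c \<notin> interior j" and d: "\<And>j. j \<in> P \<Longrightarrow> d \<notin> interior j"
  shows "interval_tiling {j \<in> P. j \<subseteq> {c..d}} {c..d}"
proof -
  have "{c..d} - \<Union>{j \<in> P. j \<subseteq> {c..d}} \<subseteq> {c, d} \<union> ({a..b} - \<Union>P)"
  proof
    fix x assume x: "x \<in> {c..d} - \<Union>{j \<in> P. j \<subseteq> {c..d}}"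
    show "x \<in> {c, d} \<union> ({a..b} - \<Union>P)"
    proof (rule ccontr)
      assume "x \<notin> {c, d} \<union> ({a..b} - \<Union>P)"
      then have "x \<noteq> c" "x \<noteq> d" "x \<in> \<Union>P"
        using x assms(2-4) by auto
      then obtain j where j: "j \<in> P" "x \<in> j" "x \<noteq> c" "x \<noteq> d"
        by blast
      then have "\<not> j \<subseteq> {c..d}"
        using x by blast
      obtain p q where "p < q" "j = {p..q}"
        using P j(1) by (auto elim: interval_tiling_Icc)
      then show False using j x c[OF j(1)] d[OF j(1)] \<open>\<not> j \<subseteq> {c..d}\<close> by auto
    qed
  qed
  moreover have "countable ({c, d} \<union> ({a..b} - \<Union>P))"
    using interval_tilingD[OF P] by auto
  ultimately have "countable ({c..d} - \<Union>{j \<in> P. j \<subseteq> {c..d}})"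
    by (rule countable_subset)
  moreover have "\<exists>p q. p < q \<and> j = {p..q} \<and> j \<subseteq> {c..d}" if "j \<in> {j \<in> P. j \<subseteq> {c..d}}" for j
    using P that unfolding interval_tiling_def by blast
  moreover have "pairwise (\<lambda>i j. interior i \<inter> interior j = {}) {j \<in> P. j \<subseteq> {c..d}}"
    using P unfolding interval_tiling_def by (auto intro: pairwise_subset)
  moreover have "countable {j \<in> P. j \<subseteq> {c..d}}"
    using P unfolding interval_tiling_def by (auto intro: countable_subset)
  ultimately show ?thesis
    unfolding interval_tiling_def by blast
qed

text \<open>Otherwise \<open>{c..d}\<close> would consist of end points of tiles and of residual
  points, and would be countable.\<close>

lemma interval_tiling_meets:
  assumes P: "interval_tiling P {a..b}" and "a \<le> c" "c < d" "d \<le> b"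
  shows "\<exists>j\<in>P. {c..d} \<inter> interior j \<noteq> {}"
proof (rule ccontr)
  assume "\<not> ?thesis"
  then have *: "{c..d} \<inter> interior j = {}" if "j \<in> P" for j
    using that by blast
  have "{c..d} \<subseteq> ({a..b} - \<Union>P) \<union> (\<Union>j\<in>P. {Inf j, Sup j})"
  proof
    fix x assume x: "x \<in> {c..d}"
    show "x \<in> ({a..b} - \<Union>P) \<union> (\<Union>j\<in>P. {Inf j, Sup j})"
    proof (cases "x \<in> \<Union>P")
      case True
      then obtain j where j: "j \<in> P" "x \<in> j" by blast
      obtain p q where "p < q" "j = {p..q}"
        using P j(1) by (auto elim: interval_tiling_Icc)
      moreover from this have "x \<notin> {p<..<q}"
        using *[OF j(1)] x by auto
      ultimately have "x \<in> {Inf j, Sup j}" using j(2) by auto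
      then show ?thesis using j(1) by blast
    qed (use x assms in auto)
  qed
  moreover have "countable (({a..b} - \<Union>P) \<union> (\<Union>j\<in>P. {Inf j, Sup j}))"
    using interval_tilingD[OF P] by auto
  ultimately show False
    using countable_subset uncountable_closed_interval[of c d] \<open>c < d\<close> by blast
qed

text \<open>Each \<open>h i\<close> is extended to a function that is constant on either side of
  \<open>i\<close>, and these extensions are summed. The summable increments dominate the sum
  uniformly, so continuity survives even where tiles accumulate.\<close>

lemma tiling_glue:
  fixes h :: "real set \<Rightarrow> real \<Rightarrow> real"
  assumes P: "interval_tiling P {a..b}" and "a \<le> b"
    and cont: "\<And>i. i \<in> P \<Longrightarrow> continuous_on i (h i)"
    and mono: "\<And>i. i \<in> P \<Longrightarrow> mono_on i (h i)"
    and summ: "(\<lambda>i. increment (h i) i) summable_on P"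
  obtains H where "continuous_on {a..b} H" "mono_on {a..b} H" "H a = 0"
    "\<And>i x y. i \<in> P \<Longrightarrow> x \<in> i \<Longrightarrow> y \<in> i \<Longrightarrow> H y - H x = h i y - h i x"
proof -
  have ab: "\<exists>c d. c < d \<and> i = {c..d} \<and> a \<le> c \<and> d \<le> b" if "i \<in> P" for i
    using P that by (auto elim: interval_tiling_Icc)
  \<comment> \<open>Clamping to the tile: \<open>g i\<close> is zero to the left of \<open>i\<close>
    and equals the full increment of \<open>h i\<close> to the right of it.\<close>
  define cl where "cl i x = max (Inf i) (min (Sup i) x)" for i :: "real set" and x
  define g where "g i x = h i (cl i x) - h i (Inf i)" for i x
  have cl_in: "cl i x \<in> i" "Inf i \<in> i" "Sup i \<in> i" if "i \<in> P" for i x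
    using ab[OF that] by (auto simp: cl_def)
  have cl_mono: "cl i x \<le> cl i y" if "x \<le> y" for i x y
    using that by (auto simp: cl_def)
  have cl_le: "Inf i \<le> cl i x" "cl i x \<le> Sup i" if "i \<in> P" for i x
    using ab[OF that] by (auto simp: cl_def)
  have g_mono: "g i x \<le> g i y" if "i \<in> P" "x \<le> y" for i x y
    using mono_onD[OF mono[OF that(1)]] cl_in cl_mono that by (auto simp: g_def)
  have g_bound: "norm (g i x) \<le> increment (h i) i" if "i \<in> P" for i x
  proof -
    have "h i (Inf i) \<le> h i (cl i x)" "h i (cl i x) \<le> h i (Sup i)"
      using mono_onD[OF mono[OF that]] cl_in[OF that] cl_le[OF that] by blast+
    then show ?thesis
      by (simp add: g_def increment_def)
  qed
  define H where "H x = (\<Sum>\<^sub>\<infinity>i\<in>P. g i x)" for x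
  have sg: "(\<lambda>i. g i x) summable_on P" for x
  proof (rule summable_on_comparison_test[OF summ])
    fix i assume i: "i \<in> P"
    show "g i x \<le> increment (h i) i" using g_bound[OF i, of x] by simp
    show "0 \<le> g i x"
      using mono_onD[OF mono[OF i]] cl_in[OF i] cl_le[OF i] by (auto simp: g_def)
  qed
  show ?thesis
  proof
    have unif: "uniform_limit {a..b} (\<lambda>X y. \<Sum>x\<in>X. g x y) H (finite_subsets_at_top P)"
      unfolding H_def using g_bound summ by (intro Weierstrass_m_test_general) auto
    have "continuous_on {a..b} (g i)" if "i \<in> P" for i
      unfolding g_def
      by (intro continuous_intros continuous_on_compose2[OF cont[OF that]])
        (auto simp: cl_def cl_in[OF that, unfolded cl_def] intro!: continuous_intros)
    then have "\<forall>\<^sub>F X in finite_subsets_at_top P. continuous_on {a..b} (\<lambda>y. \<Sum>x\<in>X. g x y)"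
      by (auto intro!: eventually_finite_subsets_at_top_weakI continuous_on_sum)
    then show "continuous_on {a..b} H"
      using unif by (rule uniform_limit_theorem) simp
    show "mono_on {a..b} H"
      unfolding H_def by (auto intro!: mono_onI infsum_mono sg g_mono)
    have "g i a = 0" if "i \<in> P" for i
      using ab[OF that] by (auto simp: g_def cl_def max_def min_def)
    then show "H a = 0"
      unfolding H_def by (simp add: infsum_0)
    fix i x y assume i: "i \<in> P" and xy: "x \<in> i" "y \<in> i"
    \<comment> \<open>The tile \<open>i\<close> lies entirely on one side of \<open>j\<close>, so
      \<open>x\<close> and \<open>y\<close> are clamped to the same end point of
      \<open>j\<close>.\<close>
    have other: "g j y = g j x" if j: "j \<in> P" "j \<noteq> i" for j
    proof -
      obtain c d where cd: "c < d" "i = {c..d}" using ab i by blast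
      obtain p q where pq: "p < q" "j = {p..q}" using ab j by blast
      have "interior i \<inter> interior j = {}"
        using P i j by (intro interval_tiling_interior) auto
      then have "d \<le> p \<or> q \<le> c"
        using cd pq interior_disjoint_Icc by blast
      then have "cl j y = cl j x"
        using cd pq xy by (auto simp: cl_def max_def min_def)
      then show ?thesis by (simp add: g_def)
    qed
    have "H y - H x = (\<Sum>\<^sub>\<infinity>j\<in>P. g j y + - g j x)"
      unfolding H_def by (subst infsum_add) (auto simp: sg summable_on_uminus infsum_uminus)
    also have "\<dots> = (\<Sum>\<^sub>\<infinity>j\<in>{i}. g j y + - g j x)"
      by (rule infsum_cong_neutral) (use other i in auto)
    also have "\<dots> = h i y - h i x"
      using xy ab[OF i] by (auto simp: g_def cl_def)
    finally show "H y - H x = h i y - h i x" .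
  qed
qed

text \<open>Mean value inequality with a countable exceptional set. If it failed, tilting
  \<open>f\<close> would give a function \<open>h\<close> with derivative
  \<open>- \<epsilon>\<close> off \<open>E\<close> but positive total increment. Its last crossing
  of a suitable level happens outside \<open>E\<close>, where the negative derivative forbids it to
  stay above the level afterwards.\<close>

lemma constant_derivative_except_countable_le:
  fixes f :: "real \<Rightarrow> real"
  assumes "a \<le> b" and cont: "continuous_on {a..b} f" and "countable E"
    and der: "\<And>x. x \<in> {a<..<b} - E \<Longrightarrow> (f has_real_derivative l) (at x)"
  shows "f b - f a \<le> l * (b - a)"
proof (rule ccontr)
  assume neg: "\<not> ?thesis"
  then have "a < b" using \<open>a \<le> b\<close> by (cases "a = b") auto
  \<comment> \<open>Half of the excess of the mean slope over \<open>l\<close>; the other half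
    remains as the mean slope of \<open>h\<close>, which gives
    \<open>h b = \<epsilon> * (b - a)\<close>.\<close>
  define \<epsilon> where "\<epsilon> = (f b - f a - l * (b - a)) / (2 * (b - a))"
  have "\<epsilon> > 0"
    using neg \<open>a < b\<close> by (simp add: \<epsilon>_def)
  have eps: "2 * \<epsilon> * (b - a) = f b - f a - l * (b - a)"
    using \<open>a < b\<close> unfolding \<epsilon>_def by (simp add: divide_simps) (simp add: algebra_simps)
  define h where "h x = f x - f a - (l + \<epsilon>) * (x - a)" for x
  have conth: "continuous_on {a..b} h"
    unfolding h_def by (intro continuous_intros cont)
  have "h a = 0" by (simp add: h_def)
  have "h b = \<epsilon> * (b - a)"
    using eps by (simp add: h_def algebra_simps)
  then have "h b > 0"
    using \<open>\<epsilon> > 0\<close> \<open>a < b\<close> by simp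
  \<comment> \<open>The image of \<open>E\<close> under \<open>h\<close> is countable, so some level
    strictly between \<open>h a\<close> and \<open>h b\<close> is not attained on
    \<open>E\<close>.\<close>
  have "\<exists>y\<in>{0<..<h b}. y \<notin> h ` E"
    using real_interval_avoid_countable_set[of 0 "h b" "h ` E"] \<open>h b > 0\<close> \<open>countable E\<close> by auto
  then obtain y where y: "0 < y" "y < h b" "y \<notin> h ` E" by auto
  define Z where "Z = {x \<in> {a..b}. h x \<le> y}"
  have "closed Z"
    using continuous_closed_preimage[OF conth _ closed_atMost[of y]]
    by (simp add: Z_def vimage_def Int_def)
  have Z: "a \<in> Z" "bdd_above Z"
    using y \<open>h a = 0\<close> \<open>a < b\<close> by (auto simp: Z_def intro: bdd_aboveI[of _ b])
  define x where "x = Sup Z"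
  have "x \<in> Z"
    unfolding x_def using \<open>closed Z\<close> Z by (intro closed_contains_Sup) auto
  then have x: "a \<le> x" "x \<le> b" "h x \<le> y" by (auto simp: Z_def)
  have above: "h t > y" if "x < t" "t \<le> b" for t
    using cSup_upper[OF _ Z(2), of t] that x by (force simp: Z_def x_def)
  have "x < b" using x y by (cases "x = b") auto
  have "h x = y"
  proof (rule ccontr)
    assume "h x \<noteq> y"
    then obtain t where "x \<le> t" "t \<le> b" "h t = y"
      using IVT'[of h x y b] x y continuous_on_subset[OF conth, of "{x..b}"] by auto
    then show False using above[of t] \<open>h x \<noteq> y\<close> by (cases "t = x") auto
  qed
  then have "x \<noteq> a" "x \<notin> E" using y \<open>h a = 0\<close> by auto
  then have "(f has_real_derivative l) (at x)"
    using x \<open>x < b\<close> by (intro der) auto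
  then have "(h has_real_derivative (- \<epsilon>)) (at x)"
    unfolding h_def by (auto intro!: derivative_eq_intros)
  then obtain \<delta> where \<delta>: "\<delta> > 0" "\<And>t. 0 < t \<Longrightarrow> t < \<delta> \<Longrightarrow> h (x + t) < h x"
    using DERIV_neg_dec_right[of h "- \<epsilon>" x] \<open>\<epsilon> > 0\<close> by auto
  define t where "t = min (\<delta> / 2) (b - x)"
  have "0 < t" "t < \<delta>" "x + t \<le> b"
    using \<delta>(1) \<open>x < b\<close> by (auto simp: t_def)
  then show False
    using \<delta>(2)[of t] above[of "x + t"] \<open>h x = y\<close> by auto
qed

lemma constant_derivative_except_countable:
  fixes f :: "real \<Rightarrow> real"
  assumes "a \<le> b" "continuous_on {a..b} f" "countable E"
    and der: "\<And>x. x \<in> {a<..<b} - E \<Longrightarrow> (f has_real_derivative l) (at x)"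
  shows "f b - f a = l * (b - a)"
proof -
  have "f b - f a \<le> l * (b - a)"
    using assms by (rule constant_derivative_except_countable_le)
  moreover have "- f b - (- f a) \<le> (- l) * (b - a)"
    using assms by (intro constant_derivative_except_countable_le[where E = E])
      (auto intro!: continuous_intros derivative_eq_intros)
  ultimately show ?thesis by simp
qed

subsection \<open>Laps\<close>

text \<open>On a flat piece a map is both increasing and decreasing, so maximal monotone intervals
  could overlap there and monotone branches would fail to be injective.\<close>

definition nowhere_constant_on :: "(real \<Rightarrow> real) \<Rightarrow> real set \<Rightarrow> bool" where
  "nowhere_constant_on T I \<longleftrightarrow> (\<forall>c d. c < d \<and> {c..d} \<subseteq> I \<longrightarrow> \<not> T constant_on {c..d})"

lemma nowhere_constant_on_subset:
  "nowhere_constant_on T I \<Longrightarrow> J \<subseteq> I \<Longrightarrow> nowhere_constant_on T J"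
  unfolding nowhere_constant_on_def by blast

lemma nowhere_constant_on_minus:
  "nowhere_constant_on T I \<Longrightarrow> nowhere_constant_on (\<lambda>x. - T x) I"
  unfolding nowhere_constant_on_def constant_on_def by (metis minus_equation_iff)

lemma antimono_on_iff_mono_on_minus:
  fixes T :: "real \<Rightarrow> real"
  shows "antimono_on K T \<longleftrightarrow> mono_on K (\<lambda>x. - T x)"
  by (simp add: monotone_on_def)

lemma monotone_map_on_minus: "monotone_map_on (\<lambda>x. - T x) K \<longleftrightarrow> monotone_map_on T K"
  by (auto simp: monotone_map_on_def antimono_on_iff_mono_on_minus)

lemma maximal_monotone_interval_minus:
  "maximal_monotone_interval (\<lambda>x. - T x) i K \<longleftrightarrow> maximal_monotone_interval T i K"
  by (simp add: maximal_monotone_interval_def monotone_map_on_minus)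

lemma monotone_map_on_inj_on:
  assumes "monotone_map_on T K" "is_interval K" "nowhere_constant_on T K"
  shows "inj_on T K"
proof (rule linorder_inj_onI)
  fix x y assume xy: "x < y" "x \<in> K" "y \<in> K"
  then have sub: "{x..y} \<subseteq> K"
    using assms(2) by (meson atLeastAtMost_iff is_interval_1 subsetI)
  show "T x \<noteq> T y"
  proof
    assume eq: "T x = T y"
    have "T z = T x" if "z \<in> {x..y}" for z
      using assms(1) sub that xy eq unfolding monotone_map_on_def monotone_on_def
      by (metis atLeastAtMost_iff order_antisym subsetD)
    then have "T constant_on {x..y}"
      unfolding constant_on_def by blast
    then show False
      using assms(3) xy sub unfolding nowhere_constant_on_def by blast
  qed
qed auto

text \<open>A nondegenerate piece decides the direction: if \<open>T\<close> were decreasing on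
  \<open>L\<close>, it would be constant on \<open>{c..d}\<close>.\<close>

lemma mono_on_if_mono_on_subinterval:
  assumes "monotone_map_on T L" "{c..d} \<subseteq> L" "c < d" "mono_on {c..d} T" "nowhere_constant_on T L"
  shows "mono_on L T"
proof (rule ccontr)
  assume "\<not> mono_on L T"
  then have "antimono_on L T"
    using assms(1) by (simp add: monotone_map_on_def)
  then have "T x = T c" if "x \<in> {c..d}" for x
    using assms(2-4) that unfolding monotone_on_def
    by (metis atLeastAtMost_iff less_eq_real_def order_antisym subsetD)
  then have "T constant_on {c..d}"
    unfolding constant_on_def by blast
  then show False
    using assms(2,3,5) unfolding nowhere_constant_on_def by blast
qed

text \<open>Two points on the same side of \<open>p\<close> lie in one common interval; points on
  opposite sides are compared through \<open>p\<close>.\<close>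

lemma mono_on_Union_intervals:
  fixes T :: "real \<Rightarrow> real"
  assumes L: "\<And>L. L \<in> \<L> \<Longrightarrow> is_interval L \<and> p \<in> L \<and> mono_on L T"
  shows "mono_on (\<Union>\<L>) T"
proof (rule mono_onI)
  fix x y assume "x \<in> \<Union>\<L>" "y \<in> \<Union>\<L>" "x \<le> y"
  then obtain L L' where LL: "L \<in> \<L>" "x \<in> L" "L' \<in> \<L>" "y \<in> L'" by blast
  consider "p \<le> x" | "x < p" "p < y" | "y \<le> p" by linarith
  then show "T x \<le> T y"
  proof cases
    case 1
    then have "x \<in> L'"
      using L[OF LL(3)] LL(4) \<open>x \<le> y\<close> unfolding is_interval_1 by blast
    then show ?thesis
      using L[OF LL(3)] LL(4) \<open>x \<le> y\<close> by (auto dest: mono_onD)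
  next
    case 2
    then have "T x \<le> T p" "T p \<le> T y"
      using L[OF LL(1)] L[OF LL(3)] LL by (auto dest: mono_onD)
    then show ?thesis by simp
  next
    case 3
    then have "y \<in> L"
      using L[OF LL(1)] LL(2) \<open>x \<le> y\<close> unfolding is_interval_1 by blast
    then show ?thesis
      using L[OF LL(1)] LL(2) \<open>x \<le> y\<close> by (auto dest: mono_onD)
  qed
qed

lemma is_interval_Union:
  fixes \<L> :: "real set set"
  assumes "\<And>L. L \<in> \<L> \<Longrightarrow> is_interval L \<and> p \<in> L"
  shows "is_interval (\<Union>\<L>)"
  unfolding is_interval_connected_1
  by (rule connected_Union) (use assms is_interval_connected_1 in blast)+

text \<open>For increasing \<open>T\<close> the union of all intervals between \<open>L\<close> and
  \<open>i\<close> on which \<open>T\<close> is increasing is maximal: the piece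
  \<open>{c..d}\<close> fixes the direction, so every monotone extension belongs to the family
  already. The decreasing case follows by passing to \<open>- T\<close>.\<close>

lemma maximal_monotone_interval_exists:
  assumes L: "is_interval L" "L \<subseteq> i" "monotone_map_on T L" "{c..d} \<subseteq> L" "c < d"
    and nc: "nowhere_constant_on T i"
  shows "\<exists>K. maximal_monotone_interval T i K \<and> L \<subseteq> K"
proof -
  have main: "\<exists>K. maximal_monotone_interval T i K \<and> L \<subseteq> K"
    if mono: "mono_on L T" and nc: "nowhere_constant_on T i" for T
  proof -
    define \<L> where "\<L> = {L'. is_interval L' \<and> L \<subseteq> L' \<and> L' \<subseteq> i \<and> mono_on L' T}"
    have "L \<in> \<L>" using L mono by (simp add: \<L>_def)
    have c: "c \<in> L" using L(4,5) by auto
    have "is_interval (\<Union>\<L>)"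
      by (rule is_interval_Union[where p = c]) (use c in \<open>auto simp: \<L>_def\<close>)
    moreover have "mono_on (\<Union>\<L>) T"
      by (rule mono_on_Union_intervals[where p = c]) (use c in \<open>auto simp: \<L>_def\<close>)
    moreover have "L' = \<Union>\<L>"
      if L': "is_interval L'" "\<Union>\<L> \<subseteq> L'" "L' \<subseteq> i" "monotone_map_on T L'" for L'
    proof -
      have "L \<subseteq> L'" using \<open>L \<in> \<L>\<close> L' by blast
      then have "mono_on L' T"
        using L' L nc mono
        by (intro mono_on_if_mono_on_subinterval[OF L'(4), of c d])
          (auto intro: nowhere_constant_on_subset mono_on_subset)
      then have "L' \<in> \<L>"
        using L' \<open>L \<subseteq> L'\<close> by (simp add: \<L>_def)
      then show ?thesis using L' by blast
    qed
    moreover have "\<Union>\<L> \<subseteq> i"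
      by (auto simp: \<L>_def)
    ultimately have "maximal_monotone_interval T i (\<Union>\<L>)"
      using \<open>L \<in> \<L>\<close> c unfolding maximal_monotone_interval_def monotone_map_on_def by blast
    then show ?thesis
      using \<open>L \<in> \<L>\<close> by blast
  qed
  show ?thesis
  proof (cases "mono_on L T")
    case False
    then have "mono_on L (\<lambda>x. - T x)"
      using L(3) by (simp add: monotone_map_on_def antimono_on_iff_mono_on_minus)
    from main[OF this nowhere_constant_on_minus[OF nc]] show ?thesis
      by (simp add: maximal_monotone_interval_minus)
  qed (use main nc in blast)
qed

text \<open>A shared nondegenerate piece forces the same direction on both intervals. Their union is
  then a monotone interval, and by maximality it equals each of them.\<close>

lemma maximal_monotone_interval_unique:
  assumes K: "maximal_monotone_interval T i K" "maximal_monotone_interval T i K'"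
    and cd: "{c..d} \<subseteq> K" "{c..d} \<subseteq> K'" "c < d" and nc: "nowhere_constant_on T i"
  shows "K = K'"
proof -
  have main: "K = K'"
    if K: "maximal_monotone_interval T i K" "maximal_monotone_interval T i K'"
      and mono: "mono_on K T" and nc: "nowhere_constant_on T i" for T
  proof -
    have i: "K \<subseteq> i" "K' \<subseteq> i" "is_interval K" "is_interval K'" "monotone_map_on T K'"
      using K by (auto simp: maximal_monotone_interval_def)
    have "mono_on K' T"
      using i cd nc mono by (intro mono_on_if_mono_on_subinterval[OF i(5), of c d])
        (auto intro: nowhere_constant_on_subset mono_on_subset)
    then have "mono_on (\<Union>{K, K'}) T" "is_interval (\<Union>{K, K'})"
      using i mono cd
      by (intro mono_on_Union_intervals[where p = c] is_interval_Union[where p = c]; auto)+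
    then have "monotone_map_on T (K \<union> K')" "is_interval (K \<union> K')" "K \<union> K' \<subseteq> i"
      using i by (auto simp: monotone_map_on_def)
    then have "K \<union> K' = K" "K \<union> K' = K'"
      using K unfolding maximal_monotone_interval_def by blast+
    then show ?thesis by blast
  qed
  show ?thesis
  proof (cases "mono_on K T")
    case False
    then have "mono_on K (\<lambda>x. - T x)"
      using K(1) by (simp add: maximal_monotone_interval_def monotone_map_on_def
          antimono_on_iff_mono_on_minus)
    with main[of "\<lambda>x. - T x"] K nowhere_constant_on_minus[OF nc] show ?thesis
      by (simp add: maximal_monotone_interval_minus)
  qed (use main K nc in blast)
qed

text \<open>Sequences in \<open>K\<close> that tend to \<open>x < y\<close> are eventually separated
  by the midpoint, so their values are ordered, and the order passes to the limit.\<close>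

lemma mono_on_closure:
  fixes T :: "real \<Rightarrow> real"
  assumes mono: "mono_on K T" and cont: "continuous_on (closure K) T"
  shows "mono_on (closure K) T"
proof (rule mono_onI)
  fix x y assume xy: "x \<in> closure K" "y \<in> closure K" "x \<le> y"
  show "T x \<le> T y"
  proof (cases "x = y")
    case False
    then have "x < y" using xy by simp
    obtain f g where f: "\<And>n. f n \<in> K" "f \<longlonglongrightarrow> x" and g: "\<And>n. g n \<in> K" "g \<longlonglongrightarrow> y"
      using xy(1,2) unfolding closure_sequential by blast
    have "\<forall>\<^sub>F n in sequentially. f n < (x + y) / 2" "\<forall>\<^sub>F n in sequentially. (x + y) / 2 < g n"
      using \<open>x < y\<close> order_tendstoD(2)[OF f(2), of "(x + y) / 2"]
        order_tendstoD(1)[OF g(2), of "(x + y) / 2"] by simp_all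
    then have ev: "\<forall>\<^sub>F n in sequentially. T (f n) \<le> T (g n)"
      by eventually_elim (auto intro!: mono_onD[OF mono] f g)
    have "(\<lambda>n. T (f n)) \<longlonglongrightarrow> T x" "(\<lambda>n. T (g n)) \<longlonglongrightarrow> T y"
      using f(1) g(1) closure_subset[of K]
      by (auto intro!: continuous_on_tendsto_compose[OF cont] f g xy always_eventually)
    then show ?thesis
      using ev by (intro tendsto_le[OF trivial_limit_sequentially])
  qed simp
qed

lemma monotone_map_on_closure:
  assumes "monotone_map_on T K" "continuous_on (closure K) T"
  shows "monotone_map_on T (closure K)"
  using assms mono_on_closure[of K T] mono_on_closure[of K "\<lambda>x. - T x"]
  by (auto simp: monotone_map_on_def antimono_on_iff_mono_on_minus continuous_on_minus)

text \<open>By continuity \<open>T\<close> is monotone on the closure of \<open>K\<close> too, so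
  maximality makes \<open>K\<close> closed.\<close>

lemma maximal_monotone_interval_Icc:
  assumes K: "maximal_monotone_interval T {a..b} K" and cont: "continuous_on {a..b} T"
  obtains c d where "c \<le> d" "K = {c..d}" "a \<le> c" "d \<le> b"
proof -
  have i: "is_interval K" "K \<noteq> {}" "K \<subseteq> {a..b}" "monotone_map_on T K"
    using K by (auto simp: maximal_monotone_interval_def)
  have sub: "closure K \<subseteq> {a..b}"
    using i(3) by (simp add: closure_minimal)
  have "monotone_map_on T (closure K)"
    using i sub cont by (auto intro!: monotone_map_on_closure intro: continuous_on_subset)
  moreover have "is_interval (closure K)"
    using i(1) by (simp add: is_interval_connected_1 connected_imp_connected_closure)
  ultimately have "closure K = K"
    using K sub closure_subset[of K] unfolding maximal_monotone_interval_def by blast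
  moreover have "bounded K"
    using bounded_subset[OF bounded_closed_interval i(3)] .
  ultimately have "connected K \<and> compact K"
    using i(1) closed_closure[of K] by (simp add: compact_eq_bounded_closed is_interval_connected_1)
  then obtain c d where "K = {c..d}"
    unfolding connected_compact_interval_1 by blast
  with i that[of c d] show ?thesis by auto
qed

text \<open>A division may contain one-point pieces; the pieces of positive length still cover the
  interval.\<close>

lemma division_interval_tiling:
  fixes a b :: real
  assumes D: "D division_of {a..b}" and "a < b"
  shows "interval_tiling {k \<in> D. measure lborel k \<noteq> 0} {a..b}" "\<Union>{k \<in> D. measure lborel k \<noteq> 0} = {a..b}"
proof -
  have D': "{k \<in> D. measure lborel k \<noteq> 0} division_of {a..b}"
    using division_of_nontrivial[of D a b] assms by simp
  then show U: "\<Union>{k \<in> D. measure lborel k \<noteq> 0} = {a..b}"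
    by (rule division_ofD)
  have "\<exists>c d. c < d \<and> k = {c..d}" if k: "k \<in> {k \<in> D. measure lborel k \<noteq> 0}" for k
  proof -
    obtain c d where "k = cbox c d"
      using division_ofD(4)[OF D' k] by blast
    then show ?thesis using k by (auto simp: measure_lborel_Icc split: if_splits)
  qed
  then show "interval_tiling {k \<in> D. measure lborel k \<noteq> 0} {a..b}"
    unfolding interval_tiling_def U using division_ofD(1,2,5)[OF D']
    by (auto simp: pairwise_def countable_finite simp del: mem_Collect_eq)
qed

text \<open>Each nondegenerate piece \<open>k\<close> of a monotone division lies in some maximal
  interval \<open>m k\<close>. Conversely, a maximal interval overlaps some piece \<open>k\<close>
  and hence equals \<open>m k\<close> by uniqueness. So there are finitely many of them, and they
  cover because the pieces do.\<close>

lemma maximal_monotone_tiling: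
  assumes "a < b" and cont: "continuous_on {a..b} T" and nc: "nowhere_constant_on T {a..b}"
    and pm: "piecewise_monotone_on T {a..b}"
  defines "M \<equiv> {K. maximal_monotone_interval T {a..b} K}"
  shows "finite M" "interval_tiling M {a..b}" "\<Union>M = {a..b}"
proof -
  obtain D0 where "D0 division_of {a..b}" and mono0: "\<And>k. k \<in> D0 \<Longrightarrow> monotone_map_on T k"
    using pm unfolding piecewise_monotone_on_def by blast
  define D where "D = {k \<in> D0. measure lborel k \<noteq> 0}"
  have D: "interval_tiling D {a..b}" "\<Union>D = {a..b}" "finite D"
    using division_interval_tiling[OF \<open>D0 division_of {a..b}\<close> \<open>a < b\<close>]
      division_of_finite[OF \<open>D0 division_of {a..b}\<close>] by (auto simp: D_def)
  have "\<exists>K. K \<in> M \<and> k \<subseteq> K" if k: "k \<in> D" for k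
  proof -
    obtain c d where cd: "c < d" "k = {c..d}" "a \<le> c" "d \<le> b"
      using D(1) k by (rule interval_tiling_Icc)
    have "monotone_map_on T k" using k mono0 by (simp add: D_def)
    then show ?thesis
      using maximal_monotone_interval_exists[of k "{a..b}" T c d] nc cd
      by (auto simp: M_def is_interval_cc)
  qed
  then obtain m where m: "\<And>k. k \<in> D \<Longrightarrow> m k \<in> M" "\<And>k. k \<in> D \<Longrightarrow> k \<subseteq> m k"
    by metis
  have nondeg: "\<exists>c d. c < d \<and> K = {c..d} \<and> a \<le> c \<and> d \<le> b" if "K \<in> M" for K
  proof -
    have max: "maximal_monotone_interval T {a..b} K" using that by (simp add: M_def)
    obtain c d where cd: "c \<le> d" "K = {c..d}" "a \<le> c" "d \<le> b"
      using maximal_monotone_interval_Icc[OF max cont] by blast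
    \<comment> \<open>A one-point \<open>K\<close> is not maximal: its point lies in a division
      piece \<open>k\<close>, so \<open>m k\<close> is a proper extension.\<close>
    moreover have "c \<noteq> d"
    proof
      assume "c = d"
      then have "K = {c}" "c \<in> {a..b}" using cd by auto
      then obtain k where k: "k \<in> D" "c \<in> k" using D(2) by blast
      obtain p q where "p < q" "k = {p..q}"
        using D(1) k(1) by (rule interval_tiling_Icc)
      have "K \<subseteq> m k" using \<open>K = {c}\<close> k m(2) by blast
      then have "m k = K"
        using max m(1)[OF k(1)] unfolding M_def maximal_monotone_interval_def by blast
      then have "{p..q} \<subseteq> {c}" using m(2)[OF k(1)] \<open>K = {c}\<close> \<open>k = {p..q}\<close> by simp
      then show False using \<open>p < q\<close> by (simp add: subset_singleton_iff)
    qed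
    ultimately show ?thesis by (metis order_le_less)
  qed
  have "M \<subseteq> m ` D"
  proof
    fix K assume K: "K \<in> M"
    then obtain c d where cd: "c < d" "K = {c..d}" "a \<le> c" "d \<le> b" using nondeg by blast
    obtain k where k: "k \<in> D" "{c..d} \<inter> interior k \<noteq> {}"
      using interval_tiling_meets[OF D(1) cd(3,1,4)] by blast
    obtain p q where pq: "p < q" "k = {p..q}"
      using D(1) k(1) by (rule interval_tiling_Icc)
    have "max c p < min d q"
      using k(2) cd(1) pq by auto
    moreover have "{max c p..min d q} \<subseteq> K" "{max c p..min d q} \<subseteq> m k"
      using cd(2) pq m(2)[OF k(1)] by auto
    ultimately have "K = m k"
      using maximal_monotone_interval_unique[OF _ _ _ _ _ nc] K m(1)[OF k(1)]
      unfolding M_def mem_Collect_eq by blast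
    then show "K \<in> m ` D" using k(1) by blast
  qed
  then show "finite M"
    using D(3) finite_surj by blast
  show U: "\<Union>M = {a..b}"
  proof
    show "\<Union>M \<subseteq> {a..b}"
      by (auto simp: M_def maximal_monotone_interval_def)
    show "{a..b} \<subseteq> \<Union>M"
      unfolding D(2)[symmetric] using m by blast
  qed
  have "interior K \<inter> interior K' = {}" if K: "K \<in> M" "K' \<in> M" "K \<noteq> K'" for K K'
  proof (rule ccontr)
    assume "interior K \<inter> interior K' \<noteq> {}"
    then obtain x where "x \<in> interior (K \<inter> K')" by auto
    then obtain e where "e > 0" "{x - e..x + e} \<subseteq> K \<inter> K'"
      unfolding mem_interior_cball cball_eq_atLeastAtMost by metis
    then show False
      using maximal_monotone_interval_unique[of T "{a..b}" K K' "x - e" "x + e"] nc K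
      by (auto simp: M_def)
  qed
  moreover have "\<exists>c d. c < d \<and> K = {c..d} \<and> K \<subseteq> {a..b}" if K: "K \<in> M" for K
  proof -
    obtain c d where "c < d" "K = {c..d}" "a \<le> c" "d \<le> b" using nondeg[OF K] by blast
    then show ?thesis by (intro exI[of _ c] exI[of _ d]) auto
  qed
  ultimately show "interval_tiling M {a..b}"
    using \<open>finite M\<close> unfolding interval_tiling_def U pairwise_def by (simp add: countable_finite)
qed

text \<open>The maximum is attained by the laps that cover \<open>{p..q}\<close>. A competing family
  injects into them by sending each member to the lap that contains it.\<close>

lemma transition_matrix_eq_card:
  assumes "a < b" and cont: "continuous_on {a..b} T" and nc: "nowhere_constant_on T {a..b}"
    and pm: "piecewise_monotone_on T {a..b}" and "p < q"
  shows "transition_matrix T {a..b} {p..q} =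
    card {K. maximal_monotone_interval T {a..b} K \<and> {p..q} \<subseteq> T ` K}"
proof -
  define M where "M = {K. maximal_monotone_interval T {a..b} K}"
  define N where "N = {K \<in> M. {p..q} \<subseteq> T ` K}"
  note M = maximal_monotone_tiling[OF assms(1-4), folded M_def]
  have "finite N" using M(1) by (simp add: N_def)
  have N_eq: "{K. maximal_monotone_interval T {a..b} K \<and> {p..q} \<subseteq> T ` K} = N"
    by (simp add: N_def M_def)
  show ?thesis
  proof (cases "{p..q} \<subseteq> T ` {a..b}")
    case True
    define \<F> where "\<F> = {F. finite F \<and>
          (\<forall>K\<in>F. is_interval K \<and> K \<subseteq> {a..b} \<and> monotone_map_on T K \<and> {p..q} \<subseteq> T ` K) \<and>
          pairwise (\<lambda>K L. interior K \<inter> interior L = {}) F}"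
    have "N \<in> \<F>"
      using \<open>finite N\<close> interval_tilingD(3)[OF M(2)]
      by (auto simp: \<F>_def N_def M_def maximal_monotone_interval_def intro: pairwise_subset)
    have bound: "card F \<le> card N" if F: "F \<in> \<F>" for F
    proof -
      \<comment> \<open>Preimages of \<open>p\<close> and \<open>q\<close> in \<open>L\<close>,
        listed in increasing order; which of them comes first depends on the direction of
        \<open>T\<close> on \<open>L\<close>.\<close>
      have xy: "\<exists>x y. x < y \<and> {x..y} \<subseteq> L \<and> ((T x = p \<and> T y = q) \<or> (T x = q \<and> T y = p))"
        if L: "L \<in> F" for L
      proof -
        have L': "is_interval L" "{p..q} \<subseteq> T ` L" using F L by (auto simp: \<F>_def)
        moreover have "p \<in> {p..q}" "q \<in> {p..q}" using \<open>p < q\<close> by auto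
        ultimately obtain x y where xy: "x \<in> L" "y \<in> L" "T x = p" "T y = q" by blast
        have "{x..y} \<subseteq> L" "{y..x} \<subseteq> L"
          using xy(1,2) L'(1) by (meson atLeastAtMost_iff is_interval_1 subsetI)+
        moreover have "x \<noteq> y"
          using xy(3,4) \<open>p < q\<close> by blast
        ultimately show ?thesis
          using xy(3,4) by (metis linorder_neqE_linordered_idom)
      qed
      have "\<exists>K. K \<in> N \<and> L \<subseteq> K" if L: "L \<in> F" for L
      proof -
        have L': "is_interval L" "L \<subseteq> {a..b}" "monotone_map_on T L" "{p..q} \<subseteq> T ` L"
          using F L by (auto simp: \<F>_def)
        obtain x y where "x < y" "{x..y} \<subseteq> L" using xy[OF L] by blast
        then obtain K where "maximal_monotone_interval T {a..b} K" "L \<subseteq> K"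
          using maximal_monotone_interval_exists[OF L'(1-3) _ _ nc] by blast
        moreover from this have "{p..q} \<subseteq> T ` K"
          using L'(4) by blast
        ultimately show ?thesis
          unfolding N_def M_def by blast
      qed
      then obtain m where m: "\<And>L. L \<in> F \<Longrightarrow> m L \<in> N" "\<And>L. L \<in> F \<Longrightarrow> L \<subseteq> m L"
        by metis
      have "inj_on m F"
      proof (rule inj_onI, rule ccontr)
        fix L L' assume L: "L \<in> F" "L' \<in> F" "m L = m L'" "L \<noteq> L'"
        have "maximal_monotone_interval T {a..b} (m L)"
          using m(1)[OF L(1)] by (simp add: N_def M_def)
        then have inj: "inj_on T (m L)"
          using nc by (auto intro!: monotone_map_on_inj_on intro: nowhere_constant_on_subset
              simp: maximal_monotone_interval_def)
        obtain x y where x: "x < y" "{x..y} \<subseteq> L" "(T x = p \<and> T y = q) \<or> (T x = q \<and> T y = p)"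
          using xy[OF L(1)] by blast
        obtain x' y' where x': "x' < y'" "{x'..y'} \<subseteq> L'"
          "(T x' = p \<and> T y' = q) \<or> (T x' = q \<and> T y' = p)"
          using xy[OF L(2)] by blast
        have "x \<in> m L" "y \<in> m L" "x' \<in> m L" "y' \<in> m L"
          using subsetD[OF m(2)[OF L(1)] subsetD[OF x(2)]] x(1)
            subsetD[OF m(2)[OF L(2)] subsetD[OF x'(2)]] x'(1) L(3) by simp_all
        \<comment> \<open>\<open>T\<close> is injective on the common lap, so \<open>p\<close> and
          \<open>q\<close> have the same preimages in \<open>L\<close> and \<open>L'\<close>. Both
          sets then contain \<open>{x..y}\<close>, against disjoint interiors.\<close>
        then have "(x = x' \<and> y = y') \<or> (x = y' \<and> y = x')"
          using x(3) x'(3) inj by (metis inj_onD)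
        then have "{x..y} \<subseteq> L'" using x(1) x'(1,2) by auto
        then have "interior {x..y} \<subseteq> interior L \<inter> interior L'"
          using interior_mono[OF x(2)] interior_mono[of "{x..y}" L'] by blast
        moreover have "interior L \<inter> interior L' = {}"
          using F L by (auto simp: \<F>_def pairwise_def)
        ultimately show False using x(1) by auto
      qed
      then show ?thesis
        using card_inj_on_le[of m F N] m(1) \<open>finite N\<close> by blast
    qed
    have "Max {card F |F. F \<in> \<F>} = card N"
    proof (rule Max_eqI)
      have "{card F |F. F \<in> \<F>} \<subseteq> {..card N}" using bound by auto
      then show "finite {card F |F. F \<in> \<F>}" by (rule finite_subset) simp
    qed (use bound \<open>N \<in> \<F>\<close> in auto)
    then show ?thesis
      using True unfolding transition_matrix_def N_eq \<F>_def mem_Collect_eq by simp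
  next
    case False
    moreover have "T ` K \<subseteq> T ` {a..b}" if "K \<in> M" for K
      using that by (auto simp: M_def maximal_monotone_interval_def)
    ultimately have "N = {}"
      unfolding N_def by blast
    then show ?thesis
      using False unfolding N_eq by (simp add: transition_matrix_def)
  qed
qed

lemma monotone_map_on_image_Icc:
  assumes "monotone_map_on T {c..d}" "continuous_on {c..d} T" "c \<le> d"
  shows "T ` {c..d} = {min (T c) (T d)..max (T c) (T d)}"
proof
  show "T ` {c..d} \<subseteq> {min (T c) (T d)..max (T c) (T d)}"
    using assms(1,3) by (auto simp: monotone_map_on_def monotone_on_def min_le_iff_disj le_max_iff_disj)
  show "{min (T c) (T d)..max (T c) (T d)} \<subseteq> T ` {c..d}"
  proof
    fix y assume y: "y \<in> {min (T c) (T d)..max (T c) (T d)}"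
    then consider "T c \<le> y \<and> y \<le> T d" | "T d \<le> y \<and> y \<le> T c" by (auto simp: min_def max_def split: if_splits)
    then show "y \<in> T ` {c..d}"
    proof cases
      case 1
      then show ?thesis using IVT'[of T c y d] assms by auto
    next
      case 2
      then show ?thesis using IVT2'[of T d y c] assms by auto
    qed
  qed
qed

subsection \<open>Slack Markov partitions\<close>

definition laps :: "(real \<Rightarrow> real) \<Rightarrow> real set \<Rightarrow> real set set" where
  "laps T i = {K. maximal_monotone_interval T i K}"

lemma laps_monotone:
  assumes "monotone_map_on T {a..b}" "a \<le> b"
  shows "laps T {a..b} = {{a..b}}"
proof -
  have "K = {a..b}" if "maximal_monotone_interval T {a..b} K" for K
    using that assms(1) is_interval_cc[of a b] unfolding maximal_monotone_interval_def by blast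
  moreover have "maximal_monotone_interval T {a..b} {a..b}"
    using assms by (auto simp: maximal_monotone_interval_def is_interval_cc)
  ultimately show ?thesis
    unfolding laps_def by blast
qed

lemma piecewise_monotone_on_if_monotone:
  assumes "monotone_map_on T {a..b}" "a \<le> b"
  shows "piecewise_monotone_on T {a..b}"
proof -
  have "{{a..b}} division_of {a..b}"
    using division_of_self[of a b] assms(2) by (simp add: box_real)
  then show ?thesis
    using assms unfolding piecewise_monotone_on_def by blast
qed

lemma markov_collectionD:
  assumes "markov_collection T P"
  shows "countable P" "pairwise (\<lambda>i j. interior i \<inter> interior j = {}) P"
    "countable ({0..1} - \<Union>P)" "\<forall>i\<in>P. \<exists>a b. 0 \<le> a \<and> a < b \<and> b \<le> 1 \<and> i = {a..b}"
    "\<forall>i\<in>P. \<forall>j\<in>P. \<forall>K. maximal_monotone_interval T i K \<longrightarrow>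
        T ` K \<inter> interior j \<noteq> {} \<longrightarrow> j \<subseteq> T ` K"
  by (insert assms[unfolded markov_collection_def], (elim conjE, assumption)+)

lemma markov_collection_tiling:
  assumes "markov_collection T P"
  shows "interval_tiling P {0..1}"
proof -
  have "\<exists>a b. a < b \<and> i = {a..b} \<and> i \<subseteq> {0..1}" if i: "i \<in> P" for i
  proof -
    obtain a b where "0 \<le> a" "a < b" "b \<le> 1" "i = {a..b}"
      using markov_collectionD(4)[OF assms] i by blast
    then show ?thesis by (intro exI[of _ a] exI[of _ b]) auto
  qed
  then show ?thesis
    using markov_collectionD(1-3)[OF assms] unfolding interval_tiling_def by blast
qed

lemma classical_imp_slack:
  assumes "classical_markov_partition T P"
  shows "slack_markov_partition T P"
proof -
  have "piecewise_monotone_on T i" if i: "i \<in> P" for i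
  proof -
    obtain a b where "a < b" "i = {a..b}"
      using assms markov_collectionD(4)[of T P] i unfolding classical_markov_partition_def by blast
    then show ?thesis
      using assms i piecewise_monotone_on_if_monotone[of T a b]
      unfolding classical_markov_partition_def by simp
  qed
  then show ?thesis
    using assms unfolding slack_markov_partition_def classical_markov_partition_def by blast
qed

lemma has_sum_finite_sum:
  fixes f :: "'a \<Rightarrow> 'b \<Rightarrow> 'c :: {topological_comm_monoid_add}"
  assumes "finite A" "\<And>a. a \<in> A \<Longrightarrow> (f a has_sum s a) B"
  shows "((\<lambda>b. \<Sum>a\<in>A. f a b) has_sum (\<Sum>a\<in>A. s a)) B"
  using assms by (induction A rule: finite_induct) (auto intro!: has_sum_add)

text \<open>Regrouping through the sum over \<open>Sigma A B\<close>: nonnegativity yields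
  summability of the double family, and disjointness makes \<open>snd\<close> injective.\<close>

lemma has_sum_disjoint_UN_nonneg:
  fixes f :: "'b \<Rightarrow> real"
  assumes f: "\<And>i. i \<in> A \<Longrightarrow> (f has_sum g i) (B i)" and g: "(g has_sum S) A"
    and nonneg: "\<And>i x. i \<in> A \<Longrightarrow> x \<in> B i \<Longrightarrow> 0 \<le> f x"
    and disj: "\<And>i j x. i \<in> A \<Longrightarrow> j \<in> A \<Longrightarrow> x \<in> B i \<Longrightarrow> x \<in> B j \<Longrightarrow> i = j"
  shows "(f has_sum S) (\<Union>i\<in>A. B i)"
proof -
  have summ: "(\<lambda>p. f (snd p)) summable_on Sigma A B"
    using f g nonneg by (intro summable_on_SigmaI[where g = g]) (auto dest: has_sum_imp_summable)
  have "((\<lambda>p. f (snd p)) has_sum S) (Sigma A B)"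
    using f g by (intro has_sum_SigmaI[OF _ _ summ, where g = g]) auto
  moreover have "inj_on snd (Sigma A B)"
    using disj by (force intro!: inj_onI)
  moreover have "snd ` Sigma A B = (\<Union>i\<in>A. B i)"
    by force
  ultimately show ?thesis
    using has_sum_reindex[of snd "Sigma A B" f S] by (simp add: o_def)
qed

lemma positive_summable_solutionD:
  assumes "positive_summable_solution P m lam v"
  shows "\<And>i. i \<in> P \<Longrightarrow> 0 < v i" "v summable_on P"
    "\<And>i. i \<in> P \<Longrightarrow> ((\<lambda>j. real (m i j) * v j) has_sum (lam * v i)) P"
proof -
  show pos: "\<And>i. i \<in> P \<Longrightarrow> 0 < v i"
    and "\<And>i. i \<in> P \<Longrightarrow> ((\<lambda>j. real (m i j) * v j) has_sum (lam * v i)) P"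
    using assms by (auto simp: positive_summable_solution_def lambda_solution_def)
  have "v summable_on P \<longleftrightarrow> (\<lambda>i. \<bar>v i\<bar>) summable_on P"
    using pos by (intro summable_on_cong) (simp add: less_imp_le)
  then show "v summable_on P"
    using assms by (simp add: positive_summable_solution_def)
qed

text \<open>Mixing is represented only by its consequence \<open>nc\<close>, which suffices for the
  study of laps. The locale is instantiated a second time with the partition into laps.\<close>

locale slack_partition =
  fixes T :: "real \<Rightarrow> real" and Q :: "real set set"
  assumes cont: "continuous_on {0..1} T" and maps: "T ` {0..1} \<subseteq> {0..1}"
    and nc: "nowhere_constant_on T {0..1}" and slack: "slack_markov_partition T Q"
begin

lemma maps_unit: "x \<in> {0..1} \<Longrightarrow> T x \<in> {0..1}"
  using maps by blast

lemma tiling: "interval_tiling Q {0..1}"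
  using slack by (auto simp: slack_markov_partition_def intro: markov_collection_tiling)

lemma markov:
  assumes "i \<in> Q" "j \<in> Q" "K \<in> laps T i" "T ` K \<inter> interior j \<noteq> {}"
  shows "j \<subseteq> T ` K"
  using slack assms markov_collectionD(5)[of T Q]
  unfolding slack_markov_partition_def laps_def by blast

lemma laps_tiling:
  assumes "i \<in> Q"
  shows "finite (laps T i)" "interval_tiling (laps T i) i" "\<Union>(laps T i) = i"
proof -
  obtain a b where ab: "a < b" "i = {a..b}" "0 \<le> a" "b \<le> 1"
    using tiling assms by (rule interval_tiling_Icc)
  then have "i \<subseteq> {0..1}" by auto
  then have "continuous_on {a..b} T" "nowhere_constant_on T {a..b}" "piecewise_monotone_on T {a..b}"
    using cont nc slack assms ab(2)
    by (auto intro: continuous_on_subset nowhere_constant_on_subset simp: slack_markov_partition_def)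
  from maximal_monotone_tiling[OF ab(1) this]
  show "finite (laps T i)" "interval_tiling (laps T i) i" "\<Union>(laps T i) = i"
    unfolding laps_def ab(2) by auto
qed

lemma lap_monotone: "K \<in> laps T i \<Longrightarrow> monotone_map_on T K"
  by (simp add: laps_def maximal_monotone_interval_def)

lemma lap_Icc:
  assumes i: "i \<in> Q" and K: "K \<in> laps T i"
  obtains c d where "c < d" "K = {c..d}" "0 \<le> c" "d \<le> 1" "T c \<noteq> T d"
    "T ` K = {min (T c) (T d)..max (T c) (T d)}"
proof -
  obtain a b where ab: "a < b" "i = {a..b}" "0 \<le> a" "b \<le> 1"
    using tiling i by (rule interval_tiling_Icc)
  obtain c d where cd: "c < d" "K = {c..d}" "a \<le> c" "d \<le> b"
    using laps_tiling(2)[OF i, unfolded ab(2)] K unfolding ab(2) by (rule interval_tiling_Icc)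
  have sub: "{c..d} \<subseteq> {0..1}" using cd ab by auto
  have mono: "monotone_map_on T {c..d}"
    using lap_monotone[OF K] cd by simp
  have "inj_on T {c..d}"
    using mono nowhere_constant_on_subset[OF nc sub] by (intro monotone_map_on_inj_on is_interval_cc)
  then have "T c \<noteq> T d"
    using cd(1) by (auto dest: inj_onD)
  moreover have "T ` K = {min (T c) (T d)..max (T c) (T d)}"
    using monotone_map_on_image_Icc[OF mono continuous_on_subset[OF cont sub]] cd by simp
  ultimately show ?thesis
    using that[of c d] cd ab by auto
qed

text \<open>By the Markov property the interior of \<open>j\<close> either misses the image of
  \<open>K\<close> or lies in the interior of that image; \<open>p\<close> and \<open>q\<close>
  belong to the image but not to its interior.\<close>

lemma lap_image_endpoints:
  assumes i: "i \<in> Q" and K: "K \<in> laps T i" and T_K: "T ` K = {p..q}" "p \<le> q" and j: "j \<in> Q"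
  shows "p \<notin> interior j" "q \<notin> interior j"
proof -
  have "T ` K \<inter> interior j = {} \<or> interior j \<subseteq> interior (T ` K)"
    using markov[OF i j K] interior_mono[of j "T ` K"] by blast
  moreover have "p \<in> T ` K" "q \<in> T ` K" "p \<notin> interior (T ` K)" "q \<notin> interior (T ` K)"
    unfolding T_K(1) using T_K(2) by auto
  ultimately show "p \<notin> interior j" "q \<notin> interior j"
    by blast+
qed

lemma lap_image_tiling:
  assumes i: "i \<in> Q" and K: "K \<in> laps T i"
  shows "interval_tiling {j \<in> Q. j \<subseteq> T ` K} (T ` K)"
proof -
  obtain c d where cd: "c < d" "K = {c..d}" "0 \<le> c" "d \<le> 1" "T c \<noteq> T d"
    "T ` K = {min (T c) (T d)..max (T c) (T d)}"
    using lap_Icc[OF i K] .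
  have "T c \<in> {0..1}" "T d \<in> {0..1}"
    using maps_unit[of c] maps_unit[of d] cd by auto
  moreover have "min (T c) (T d) \<notin> interior j" "max (T c) (T d) \<notin> interior j" if "j \<in> Q" for j
    using lap_image_endpoints[OF i K cd(6) _ that] by auto
  ultimately show ?thesis
    unfolding cd(6) by (intro interval_tiling_subset[OF tiling]) auto
qed

lemma increment_lap_image:
  assumes i: "i \<in> Q" and K: "K \<in> laps T i"
    and F: "continuous_on {0..1} F" "mono_on {0..1} F"
  shows "(increment F has_sum increment F (T ` K)) {j \<in> Q. j \<subseteq> T ` K}"
proof -
  obtain c d where cd: "c < d" "K = {c..d}" "0 \<le> c" "d \<le> 1" "T c \<noteq> T d"
    "T ` K = {min (T c) (T d)..max (T c) (T d)}"
    using lap_Icc[OF i K] .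
  have "T c \<in> {0..1}" "T d \<in> {0..1}"
    using maps_unit[of c] maps_unit[of d] cd by auto
  then have sub: "{min (T c) (T d)..max (T c) (T d)} \<subseteq> {0..1}" by auto
  have "increment F (T ` K) = F (max (T c) (T d)) - F (min (T c) (T d))"
    unfolding cd(6) by (rule increment_Icc) simp
  then show ?thesis
    using increment_has_sum[OF lap_image_tiling[OF i K, unfolded cd(6)] _
        continuous_on_subset[OF F(1) sub] mono_on_subset[OF F(2) sub]]
    unfolding cd(6) by simp
qed

text \<open>Yields the strict positivity of lifted solutions. The image is nondegenerate since
  \<open>T\<close> is nowhere constant, so it meets the interior of some element and contains it by
  the Markov property.\<close>

lemma lap_image_nonempty:
  assumes i: "i \<in> Q" and K: "K \<in> laps T i"
  shows "\<exists>j\<in>Q. j \<subseteq> T ` K"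
proof -
  obtain c d where cd: "c < d" "K = {c..d}" "0 \<le> c" "d \<le> 1" "T c \<noteq> T d"
    "T ` K = {min (T c) (T d)..max (T c) (T d)}"
    using lap_Icc[OF i K] .
  have "T c \<in> {0..1}" "T d \<in> {0..1}"
    using maps_unit[of c] maps_unit[of d] cd by auto
  then have "\<exists>j\<in>Q. {min (T c) (T d)..max (T c) (T d)} \<inter> interior j \<noteq> {}"
    using cd(5) by (intro interval_tiling_meets[OF tiling]) auto
  then show ?thesis
    using markov[OF i _ K] unfolding cd(6) by blast
qed

lemma transition_matrix_eq_card_laps:
  assumes "i \<in> Q" "j \<in> Q"
  shows "transition_matrix T i j = card {K \<in> laps T i. j \<subseteq> T ` K}"
proof -
  obtain a b where ab: "a < b" "i = {a..b}" "0 \<le> a" "b \<le> 1"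
    using tiling assms(1) by (rule interval_tiling_Icc)
  obtain p q where pq: "p < q" "j = {p..q}"
    using tiling assms(2) by (rule interval_tiling_Icc)
  have "i \<subseteq> {0..1}" using ab by auto
  then have "continuous_on {a..b} T" "nowhere_constant_on T {a..b}" "piecewise_monotone_on T {a..b}"
    using cont nc slack assms ab(2)
    by (auto intro: continuous_on_subset nowhere_constant_on_subset simp: slack_markov_partition_def)
  from transition_matrix_eq_card[OF ab(1) this pq(1)] show ?thesis
    by (simp add: laps_def ab(2) pq(2))
qed

text \<open>Since matrix entries count laps, a row sum splits into finitely many sums, one per lap,
  over the elements that the image of the lap covers.\<close>

lemma transition_matrix_row:
  assumes i: "i \<in> Q" and v: "\<And>K. K \<in> laps T i \<Longrightarrow> (v has_sum w K) {j \<in> Q. j \<subseteq> T ` K}"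
  shows "((\<lambda>j. real (transition_matrix T i j) * v j) has_sum (\<Sum>K\<in>laps T i. w K)) Q"
proof -
  have fin: "finite (laps T i)" using i by (rule laps_tiling)
  have "((\<lambda>j. if j \<subseteq> T ` K then v j else 0) has_sum w K) Q" if "K \<in> laps T i" for K
    using v[OF that] by (rule iffD1[OF has_sum_cong_neutral, rotated -1]) auto
  then have "((\<lambda>j. \<Sum>K\<in>laps T i. if j \<subseteq> T ` K then v j else 0) has_sum (\<Sum>K\<in>laps T i. w K)) Q"
    using fin by (intro has_sum_finite_sum)
  moreover have "(\<Sum>K\<in>laps T i. if j \<subseteq> T ` K then v j else 0) = real (transition_matrix T i j) * v j"
    if "j \<in> Q" for j
    using fin unfolding transition_matrix_eq_card_laps[OF i that]
    by (simp add: sum.If_cases Int_def)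
  ultimately show ?thesis
    by (simp cong: has_sum_cong)
qed

section \<open>Refinement of a slack partition by its laps\<close>

definition refinement :: "real set set" where
  "refinement = (\<Union>i\<in>Q. laps T i)"

lemma lap_subset: "K \<in> laps T i \<Longrightarrow> K \<subseteq> i"
  by (simp add: laps_def maximal_monotone_interval_def)

lemma laps_disjoint:
  assumes "i \<in> Q" "j \<in> Q" "K \<in> laps T i" "K \<in> laps T j"
  shows "i = j"
proof (rule ccontr)
  assume "i \<noteq> j"
  obtain c d where "c < d" "K = {c..d}" using lap_Icc[OF assms(1,3)] .
  then have "interior K \<noteq> {}" by simp
  moreover have "interior K \<subseteq> interior i \<inter> interior j"
    using assms by (simp add: interior_mono lap_subset)
  ultimately show False
    using interval_tiling_interior[OF tiling assms(1,2) \<open>i \<noteq> j\<close>] by blast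
qed

text \<open>If the image of a lap meets the interior of a lap \<open>L\<close> of \<open>j\<close>,
  then it meets the interior of \<open>j\<close>. The Markov property of \<open>Q\<close> puts all
  of \<open>j\<close>, and with it \<open>L\<close>, into the image.\<close>

lemma refinement_classical: "classical_markov_partition T refinement"
proof -
  have mono: "\<forall>K\<in>refinement. monotone_map_on T K"
    by (auto simp: refinement_def lap_monotone)
  have cnt: "countable refinement"
    unfolding refinement_def using interval_tilingD(1)[OF tiling]
    by (intro countable_UN) (auto intro: countable_finite laps_tiling(1))
  have Icc: "\<forall>K\<in>refinement. \<exists>a b. 0 \<le> a \<and> a < b \<and> b \<le> 1 \<and> K = {a..b}"
  proof
    fix K assume "K \<in> refinement"
    then obtain i where i: "i \<in> Q" "K \<in> laps T i" by (auto simp: refinement_def)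
    obtain c d where "c < d" "K = {c..d}" "0 \<le> c" "d \<le> 1"
      using lap_Icc[OF i] .
    then show "\<exists>a b. 0 \<le> a \<and> a < b \<and> b \<le> 1 \<and> K = {a..b}"
      by blast
  qed
  have "interior K \<inter> interior L = {}"
    if KL: "K \<in> refinement" "L \<in> refinement" "K \<noteq> L" for K L
  proof -
    obtain i j where ij: "i \<in> Q" "K \<in> laps T i" "j \<in> Q" "L \<in> laps T j"
      using KL by (auto simp: refinement_def)
    show ?thesis
    proof (cases "i = j")
      case True
      then show ?thesis
        using interval_tiling_interior[OF laps_tiling(2)] ij KL(3) by blast
    next
      case False
      have "interior K \<subseteq> interior i" "interior L \<subseteq> interior j"
        using ij by (simp_all add: interior_mono lap_subset)
      then show ?thesis
        using interval_tiling_interior[OF tiling ij(1,3) False] by blast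
    qed
  qed
  then have disj: "pairwise (\<lambda>i j. interior i \<inter> interior j = {}) refinement"
    by (auto simp: pairwise_def)
  have "\<Union>refinement = \<Union>Q"
    unfolding refinement_def using laps_tiling(3) by blast
  then have rest: "countable ({0..1} - \<Union>refinement)"
    using interval_tilingD(2)[OF tiling] by simp
  have "L \<subseteq> T ` K'"
    if K: "K \<in> refinement" and L: "L \<in> refinement" and K': "maximal_monotone_interval T K K'"
      and meet: "T ` K' \<inter> interior L \<noteq> {}" for K L K'
  proof -
    obtain a b where "a < b" "K = {a..b}" using Icc K by blast
    then have "K' = K"
      using K' laps_monotone[of T a b] mono K by (auto simp: laps_def)
    obtain i j where ij: "i \<in> Q" "K \<in> laps T i" "j \<in> Q" "L \<in> laps T j"
      using K L by (auto simp: refinement_def)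
    have "L \<subseteq> j" using ij by (simp add: lap_subset)
    then have "T ` K \<inter> interior j \<noteq> {}"
      using meet interior_mono[of L j] unfolding \<open>K' = K\<close> by blast
    then show ?thesis
      using markov[OF ij(1,3,2)] \<open>L \<subseteq> j\<close> unfolding \<open>K' = K\<close> by blast
  qed
  then show ?thesis
    unfolding classical_markov_partition_def markov_collection_def
    by (intro conjI cnt Icc disj rest mono) blast
qed

lemma refinement_slack_partition: "slack_partition T refinement"
  using cont maps nc classical_imp_slack[OF refinement_classical] by unfold_locales

lemma refinement_infinite:
  assumes "infinite Q"
  shows "infinite refinement"
proof
  assume fin: "finite refinement"
  have "laps T i \<noteq> {}" if i: "i \<in> Q" for i
  proof -
    obtain a b where "a < b" "i = {a..b}"
      using tiling i by (rule interval_tiling_Icc)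
    then show ?thesis using laps_tiling(3)[OF i] by auto
  qed
  then obtain k where k: "\<And>i. i \<in> Q \<Longrightarrow> k i \<in> laps T i" by (meson all_not_in_conv)
  then have "inj_on k Q"
    using laps_disjoint by (metis inj_onI)
  moreover have "k ` Q \<subseteq> refinement"
    using k by (auto simp: refinement_def)
  ultimately show False
    using fin assms by (meson finite_imageD finite_subset)
qed

text \<open>The lifted \<open>u\<close> distributes \<open>v i\<close> over the laps of
  \<open>i\<close>, by the row equation at \<open>i\<close>. Hence the sum of \<open>u\<close> over
  the laps in the image of \<open>K\<close> equals the sum \<open>w K\<close> of \<open>v\<close>
  over the elements of \<open>Q\<close> in that image, which is \<open>lam * u K\<close>.\<close>

lemma refinement_solution:
  assumes v: "positive_summable_solution Q (transition_matrix T) lam v" and "lam > 0"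
  shows "\<exists>u. positive_summable_solution refinement (transition_matrix T) lam u"
proof -
  note pos = positive_summable_solutionD(1)[OF v]
  note summ = positive_summable_solutionD(2)[OF v]
  note row = positive_summable_solutionD(3)[OF v]
  define w where "w K = (\<Sum>\<^sub>\<infinity>j\<in>{j \<in> Q. j \<subseteq> T ` K}. v j)" for K
  define u where "u K = w K / lam" for K
  have w: "(v has_sum w K) {j \<in> Q. j \<subseteq> T ` K}" for K
    unfolding w_def using summ by (intro has_sum_infsum summable_on_subset_banach[OF summ]) auto
  have w_pos: "0 < w K" if iK: "i \<in> Q" "K \<in> laps T i" for i K
  proof -
    obtain j where j: "j \<in> Q" "j \<subseteq> T ` K" using lap_image_nonempty[OF iK] by blast
    have "sum v {j} \<le> w K"
      using j pos by (intro finite_sum_le_has_sum[OF w]) (auto intro: less_imp_le)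
    then show ?thesis using pos[OF j(1)] by simp
  qed
  have u_pos: "0 < u K" if "K \<in> refinement" for K
    using that w_pos \<open>lam > 0\<close> by (auto simp: refinement_def u_def)
  have u_laps: "(u has_sum v i) (laps T i)" if "i \<in> Q" for i
  proof -
    have "lam * v i = (\<Sum>K\<in>laps T i. w K)"
      using transition_matrix_row[OF that w] row[OF that] has_sum_unique by blast
    then have "v i = (\<Sum>K\<in>laps T i. u K)"
      using \<open>lam > 0\<close> by (simp add: u_def field_simps flip: sum_divide_distrib)
    then show ?thesis
      using laps_tiling(1)[OF that] by (simp add: has_sum_finite_iff)
  qed
  have UN: "(u has_sum S) (\<Union>i\<in>A. laps T i)" if A: "A \<subseteq> Q" "(v has_sum S) A" for A S
  proof (rule has_sum_disjoint_UN_nonneg[OF _ A(2)])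
    show "(u has_sum v i) (laps T i)" if "i \<in> A" for i
      using that A(1) u_laps by blast
    show "0 \<le> u K" if "i \<in> A" "K \<in> laps T i" for i K
      using that A(1) by (intro less_imp_le[OF u_pos]) (auto simp: refinement_def)
    show "i = j" if "i \<in> A" "j \<in> A" "K \<in> laps T i" "K \<in> laps T j" for i j K
      using that A(1) laps_disjoint by blast
  qed
  interpret R: slack_partition T refinement
    by (rule refinement_slack_partition)
  have "((\<lambda>L. real (transition_matrix T K L) * u L) has_sum (lam * u K)) refinement"
    if K: "K \<in> refinement" for K
  proof -
    obtain i where i: "i \<in> Q" "K \<in> laps T i"
      using K by (auto simp: refinement_def)
    obtain c d where "c < d" "K = {c..d}" using lap_Icc[OF i] .
    then have lapsK: "laps T K = {K}"
      using lap_monotone[OF i(2)] laps_monotone by simp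
    \<comment> \<open>A lap inside the image of \<open>K\<close> belongs to some \<open>j\<close>
      whose interior meets this image, so the Markov property brings in \<open>j\<close> with all
      its laps.\<close>
    have "(\<Union>j\<in>{j \<in> Q. j \<subseteq> T ` K}. laps T j) = {L \<in> refinement. L \<subseteq> T ` K}"
    proof (intro equalityI subsetI)
      fix L assume "L \<in> {L \<in> refinement. L \<subseteq> T ` K}"
      then obtain j where j: "j \<in> Q" "L \<in> laps T j" "L \<subseteq> T ` K"
        by (auto simp: refinement_def)
      obtain p q where "p < q" "L = {p..q}" using lap_Icc[OF j(1,2)] .
      then have "interior L \<noteq> {}" by simp
      moreover have "interior L \<subseteq> interior j" "interior L \<subseteq> L"
        using j by (simp_all add: interior_mono lap_subset interior_subset)
      ultimately have "T ` K \<inter> interior j \<noteq> {}" using j(3) by blast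
      then have "j \<subseteq> T ` K" using markov[OF i(1) j(1) i(2)] by blast
      then show "L \<in> (\<Union>j\<in>{j \<in> Q. j \<subseteq> T ` K}. laps T j)" using j by blast
    next
      fix L assume "L \<in> (\<Union>j\<in>{j \<in> Q. j \<subseteq> T ` K}. laps T j)"
      then obtain j where j: "j \<in> Q" "j \<subseteq> T ` K" "L \<in> laps T j" by blast
      then show "L \<in> {L \<in> refinement. L \<subseteq> T ` K}"
        using lap_subset[OF j(3)] unfolding refinement_def by blast
    qed
    then have "(u has_sum w K) {L \<in> refinement. L \<subseteq> T ` K}"
      using UN[OF _ w[of K]] by auto
    then have "((\<lambda>L. real (transition_matrix T K L) * u L) has_sum (\<Sum>K'\<in>laps T K. w K')) refinement"
      using R.transition_matrix_row[OF K, of u w] lapsK by simp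
    then show ?thesis
      using \<open>lam > 0\<close> by (simp add: lapsK u_def)
  qed
  moreover have "refinement \<noteq> {}"
  proof -
    obtain i where i: "i \<in> Q"
      using v by (auto simp: positive_summable_solution_def lambda_solution_def)
    then obtain a b where "a < b" "i = {a..b}"
      using tiling by (auto elim: interval_tiling_Icc)
    then have "laps T i \<noteq> {}" using laps_tiling(3)[OF i] by auto
    then show ?thesis using i by (auto simp: refinement_def)
  qed
  moreover have "u summable_on refinement"
    using UN[OF order_refl] summ unfolding refinement_def
    by (meson has_sum_imp_summable has_sum_infsum)
  then have "(\<lambda>K. \<bar>u K\<bar>) summable_on refinement"
    using u_pos summable_on_cong[of refinement u "\<lambda>K. \<bar>u K\<bar>"] by (simp add: less_imp_le)
  ultimately have "positive_summable_solution refinement (transition_matrix T) lam u"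
    unfolding positive_summable_solution_def lambda_solution_def
    using u_pos by (metis ex_in_conv less_imp_le less_irrefl)
  then show ?thesis by blast
qed

end

subsection \<open>The conjugacy as a fixed point\<close>

text \<open>An interval that \<open>T\<close> collapses to a point has one-point images ever after,
  and these cannot meet two disjoint open sets at the same time.\<close>

lemma topologically_mixing_nowhere_constant:
  assumes "topologically_mixing T"
  shows "nowhere_constant_on T {0..1}"
  unfolding nowhere_constant_on_def
proof (intro allI impI notI, elim conjE)
  fix c d :: real assume cd: "c < d" "{c..d} \<subseteq> {0..1}" and "T constant_on {c..d}"
  then obtain t where t: "\<And>x. x \<in> {c..d} \<Longrightarrow> T x = t"
    unfolding constant_on_def by blast
  define U where "U = {c<..<d}"
  define V where "V = {0..1} \<inter> {..<(1/3::real)}"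
  define W where "W = {0..1} \<inter> {(2/3::real)<..}"
  have "(c + d) / 2 \<in> U" "(0::real) \<in> V" "(1::real) \<in> W"
    using cd(1) by (auto simp: U_def V_def W_def)
  then have ne: "U \<noteq> {}" "V \<noteq> {}" "W \<noteq> {}" by blast+
  have "U = {0..1} \<inter> U"
    using cd by (force simp: U_def)
  moreover have "open U" by (simp add: U_def)
  ultimately have op: "openin (top_of_set {0..1}) U"
    by (metis openin_open_Int)
  have VW: "openin (top_of_set {0..1}) V" "openin (top_of_set {0..1}) W"
    by (auto simp: V_def W_def intro!: openin_open_Int)
  obtain n1 where n1: "\<And>m. m \<ge> n1 \<Longrightarrow> (T ^^ m) ` U \<inter> V \<noteq> {}"
    using assms op ne VW unfolding topologically_mixing_def by meson
  obtain n2 where n2: "\<And>m. m \<ge> n2 \<Longrightarrow> (T ^^ m) ` U \<inter> W \<noteq> {}"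
    using assms op ne VW unfolding topologically_mixing_def by meson
  define m where "m = n1 + n2"
  have collapse: "(T ^^ Suc m) x = (T ^^ m) t" if "x \<in> U" for x
    using that t[of x] by (simp add: U_def funpow_swap1)
  obtain x where x: "x \<in> U" "(T ^^ Suc m) x \<in> V"
    using n1[of "Suc m"] by (auto simp: m_def)
  obtain y where y: "y \<in> U" "(T ^^ Suc m) y \<in> W"
    using n2[of "Suc m"] by (auto simp: m_def)
  have "(T ^^ m) t \<in> V \<inter> W"
    using x y by (simp only: collapse Int_iff)
  then show False by (auto simp: V_def W_def)
qed

lemma strict_mono_on_if_mixing:
  fixes F :: "real \<Rightarrow> real"
  assumes mixing: "topologically_mixing T"
    and T: "continuous_on {0..1} T" "T ` {0..1} \<subseteq> {0..1}" and Q: "interval_tiling Q {0..1}"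
    and F: "continuous_on {0..1} F" "mono_on {0..1} F" "F 0 \<noteq> F 1"
    and const: "\<And>i x y. i \<in> Q \<Longrightarrow> x \<in> i \<Longrightarrow> y \<in> i \<Longrightarrow> F x = F y \<Longrightarrow> F (T x) = F (T y)"
  shows "strict_mono_on {0..1} F"
proof (rule ccontr)
  assume "\<not> strict_mono_on {0..1} F"
  then obtain x y where xy: "x \<in> {0..1}" "y \<in> {0..1}" "x < y" "F y \<le> F x"
    by (auto simp: strict_mono_on_def not_less)
  have step: "F constant_on T ` J"
    if J: "J \<subseteq> {0..1}" "connected J" "F constant_on J" for J
  proof -
    define H where "H = (\<lambda>x. F (T x)) ` J"
    have "continuous_on J (\<lambda>x. F (T x))"
      using T F(1) J(1) by (intro continuous_on_compose2[OF F(1)]) (auto intro: continuous_on_subset)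
    then have "connected H"
      unfolding H_def using J(2) by (intro connected_continuous_image)
    \<comment> \<open>\<open>F \<circ> T\<close> takes at most one value on the part of
      \<open>J\<close> in each tile, and the residue adds countably many. A connected countable set
      of reals has at most one point.\<close>
    have *: "\<exists>h. (\<lambda>x. F (T x)) ` (J \<inter> i) \<subseteq> {h}" if i: "i \<in> Q" for i
    proof (cases "J \<inter> i = {}")
      case False
      then obtain z where z: "z \<in> J" "z \<in> i" by blast
      have "F (T w) = F (T z)" if "w \<in> J \<inter> i" for w
        using that z i J(3) by (intro const[OF i]) (auto simp: constant_on_def)
      then show ?thesis by (intro exI[of _ "F (T z)"]) auto
    qed auto
    have "H \<subseteq> (\<lambda>x. F (T x)) ` ({0..1} - \<Union>Q) \<union> (\<Union>i\<in>Q. (\<lambda>x. F (T x)) ` (J \<inter> i))"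
      using J(1) by (auto simp: H_def)
    moreover have "countable \<dots>"
    proof -
      have "countable ((\<lambda>x. F (T x)) ` (J \<inter> i))" if "i \<in> Q" for i
        using *[OF that] by (meson countable_empty countable_insert countable_subset)
      then show ?thesis
        using interval_tilingD[OF Q] by (intro countable_Un countable_image[of "{0..1} - _"] countable_UN)
    qed
    ultimately have "countable H" by (rule countable_subset)
    have "\<not> p < q" if "p \<in> H" "q \<in> H" for p q
    proof
      assume "p < q"
      have "{p..q} \<subseteq> H"
        using \<open>connected H\<close> that by (rule connected_contains_Icc)
      then show False
        using \<open>countable H\<close> \<open>p < q\<close> countable_subset uncountable_closed_interval by blast
    qed
    then have eq: "p = q" if "p \<in> H" "q \<in> H" for p q
      using that by (meson linorder_cases)
    show ?thesis
    proof (cases "J = {}")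
      case False
      then obtain z where "z \<in> J" by blast
      then have "F (T w) = F (T z)" if "w \<in> J" for w
        using that by (intro eq) (auto simp: H_def)
      then show ?thesis
        unfolding constant_on_def by blast
    qed (simp add: constant_on_def)
  qed
  have iter: "(T ^^ n) ` {x..y} \<subseteq> {0..1} \<and> connected ((T ^^ n) ` {x..y}) \<and> F constant_on (T ^^ n) ` {x..y}" for n
  proof (induction n)
    case 0
    have "F z = F x" if "z \<in> {x..y}" for z
      using mono_onD[OF F(2), of x z] mono_onD[OF F(2), of z y] that xy by auto
    then have "F constant_on {x..y}"
      unfolding constant_on_def by blast
    then show ?case
      using xy by simp
  next
    case (Suc n)
    have eq: "(T ^^ Suc n) ` {x..y} = T ` (T ^^ n) ` {x..y}"
      by (simp add: image_comp)
    have "connected (T ` (T ^^ n) ` {x..y})"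
      using Suc continuous_on_subset[OF T(1)] by (metis connected_continuous_image)
    moreover have "T ` (T ^^ n) ` {x..y} \<subseteq> {0..1}"
      using Suc T(2) by blast
    ultimately show ?case
      unfolding eq using Suc step[of "(T ^^ n) ` {x..y}"] by simp
  qed
  \<comment> \<open>The level \<open>m\<close> separates \<open>F 0\<close> from \<open>F 1\<close>,
    so \<open>V\<close> and \<open>W\<close> are nonempty, and no set on which \<open>F\<close> is
    constant meets both.\<close>
  define m where "m = (F 0 + F 1) / 2"
  define U where "U = {x<..<y}"
  define V where "V = {0..1} \<inter> F -` {..<m}"
  define W where "W = {0..1} \<inter> F -` {m<..}"
  have "F 0 < F 1"
    using F(3) mono_onD[OF F(2), of 0 1] by simp
  then have "(x + y) / 2 \<in> U" "0 \<in> V" "1 \<in> W"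
    using xy(3) by (auto simp: U_def V_def W_def m_def)
  then have ne: "U \<noteq> {}" "V \<noteq> {}" "W \<noteq> {}" by blast+
  have "U = {0..1} \<inter> U"
    using xy by (force simp: U_def)
  moreover have "open U" by (simp add: U_def)
  ultimately have op: "openin (top_of_set {0..1}) U"
    by (metis openin_open_Int)
  have VW: "openin (top_of_set {0..1}) V" "openin (top_of_set {0..1}) W"
    unfolding V_def W_def by (intro continuous_openin_preimage_gen F(1); simp)+
  obtain n1 where n1: "\<And>m. m \<ge> n1 \<Longrightarrow> (T ^^ m) ` U \<inter> V \<noteq> {}"
    using mixing op ne VW unfolding topologically_mixing_def by meson
  obtain n2 where n2: "\<And>m. m \<ge> n2 \<Longrightarrow> (T ^^ m) ` U \<inter> W \<noteq> {}"
    using mixing op ne VW unfolding topologically_mixing_def by meson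
  define n where "n = n1 + n2"
  have "U \<subseteq> {x..y}" by (auto simp: U_def)
  then have "(T ^^ n) ` U \<subseteq> (T ^^ n) ` {x..y}" by (rule image_mono)
  moreover have "(T ^^ n) ` U \<inter> V \<noteq> {}" "(T ^^ n) ` U \<inter> W \<noteq> {}"
    using n1[of n] n2[of n] by (simp_all add: n_def)
  ultimately obtain v w where vw: "v \<in> V" "w \<in> W" "v \<in> (T ^^ n) ` {x..y}" "w \<in> (T ^^ n) ` {x..y}"
    by blast
  then have "F v = F w"
    using iter[of n] unfolding constant_on_def by metis
  then show False
    using vw(1,2) by (auto simp: V_def W_def)
qed

section \<open>The contraction on functions with prescribed increments\<close>

context slack_partition
begin

lemma endpoint_not_interior:
  assumes i: "{a..b} \<in> Q" "a < b" and j: "j \<in> Q"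
  shows "a \<notin> interior j"
proof
  assume a: "a \<in> interior j"
  obtain p q where pq: "p < q" "j = {p..q}"
    using tiling j by (rule interval_tiling_Icc)
  have "{a..b} \<noteq> j" using a by auto
  then have "interior {a..b} \<inter> interior j = {}"
    using interval_tiling_interior[OF tiling i(1) j] by blast
  moreover have "(a + min b q) / 2 \<in> interior {a..b} \<inter> interior j"
    using a pq i(2) by auto
  ultimately show False by blast
qed

text \<open>A point in no interior cuts the tiling, so the value there is the sum of the increments
  over the elements to its left.\<close>

lemma value_eq_if_increments_eq:
  assumes F: "continuous_on {0..1} F" "mono_on {0..1} F" "F 0 = 0"
    and G: "continuous_on {0..1} G" "mono_on {0..1} G" "G 0 = 0"
    and eq: "\<And>i. i \<in> Q \<Longrightarrow> increment F i = increment G i"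
    and c: "c \<in> {0..1}" "\<And>j. j \<in> Q \<Longrightarrow> c \<notin> interior j"
  shows "F c = G c"
proof -
  have sub: "{0..c} \<subseteq> {0..1}" using c by auto
  have "0 \<notin> interior j" if j: "j \<in> Q" for j
  proof -
    obtain p q where "p < q" "j = {p..q}" "0 \<le> p"
      using tiling j by (rule interval_tiling_Icc)
    then show ?thesis by simp
  qed
  then have *: "interval_tiling {j \<in> Q. j \<subseteq> {0..c}} {0..c}"
    using c by (intro interval_tiling_subset[OF tiling]) auto
  have "(increment F has_sum (F c - F 0)) {j \<in> Q. j \<subseteq> {0..c}}"
    using c F sub by (intro increment_has_sum[OF *]) (auto intro: continuous_on_subset mono_on_subset)
  moreover have "(increment G has_sum (G c - G 0)) {j \<in> Q. j \<subseteq> {0..c}}"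
    using c G sub by (intro increment_has_sum[OF *]) (auto intro: continuous_on_subset mono_on_subset)
  then have "(increment F has_sum (G c - G 0)) {j \<in> Q. j \<subseteq> {0..c}}"
    by (rule iffD2[OF has_sum_cong, rotated]) (use eq in auto)
  ultimately show ?thesis
    using has_sum_unique F(3) G(3) by fastforce
qed

text \<open>The set on which the operator acts. By \<open>value_eq_if_increments_eq\<close> two of
  its members can differ only in the interiors of partition elements.\<close>

definition solution_map :: "(real set \<Rightarrow> real) \<Rightarrow> (real \<Rightarrow> real) \<Rightarrow> bool" where
  "solution_map u F \<longleftrightarrow> continuous_on {0..1} F \<and> mono_on {0..1} F \<and> F 0 = 0 \<and>
     (\<forall>i\<in>Q. increment F i = u i)"

lemma classical_laps:
  assumes "classical_markov_partition T Q" "i \<in> Q"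
  shows "laps T i = {i}"
proof -
  obtain a b where "a < b" "i = {a..b}"
    using tiling assms(2) by (rule interval_tiling_Icc)
  then show ?thesis
    using assms laps_monotone[of T a b] by (simp add: classical_markov_partition_def)
qed

lemma classical_row:
  assumes cls: "classical_markov_partition T Q" and i: "i \<in> Q"
    and u: "positive_summable_solution Q (transition_matrix T) lam u"
  shows "(u has_sum (lam * u i)) {j \<in> Q. j \<subseteq> T ` i}"
proof -
  note summ = positive_summable_solutionD(2)[OF u]
  note row = positive_summable_solutionD(3)[OF u i]
  have w: "(u has_sum infsum u {j \<in> Q. j \<subseteq> T ` K}) {j \<in> Q. j \<subseteq> T ` K}" for K
    using summ by (intro has_sum_infsum summable_on_subset_banach[OF summ]) auto
  have "infsum u {j \<in> Q. j \<subseteq> T ` i} = lam * u i"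
    using transition_matrix_row[OF i w] row has_sum_unique
    by (fastforce simp: classical_laps[OF cls i])
  then show ?thesis
    using w[of i] by simp
qed

text \<open>One application of the operator. The sign in \<open>s i\<close> makes each branch of the
  pullback increasing, and the row equation shows that its increment over \<open>i\<close> is again
  \<open>u i\<close>; the branches are then glued.\<close>

lemma solution_map_iterate:
  assumes cls: "classical_markov_partition T Q" and "lam > 0"
    and u: "positive_summable_solution Q (transition_matrix T) lam u" and F: "solution_map u F"
  defines "s \<equiv> \<lambda>i. if mono_on i T then 1 / lam else - 1 / lam"
  shows "\<exists>G. solution_map u G \<and>
    (\<forall>i\<in>Q. \<forall>x\<in>i. \<forall>y\<in>i. G y - G x = s i * (F (T y) - F (T x)))"
proof -
  have F': "continuous_on {0..1} F" "mono_on {0..1} F" "\<And>i. i \<in> Q \<Longrightarrow> increment F i = u i"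
    using F by (auto simp: solution_map_def)
  have summ: "u summable_on Q"
    using u by (rule positive_summable_solutionD)
  define h where "h i x = s i * F (T x)" for i x
  have *: "continuous_on i (h i) \<and> mono_on i (h i) \<and> increment (h i) i = u i" if i: "i \<in> Q" for i
  proof -
    have ii: "i \<in> laps T i" using classical_laps[OF cls i] by simp
    obtain a b where ab: "a < b" "i = {a..b}" "0 \<le> a" "b \<le> 1"
      "T ` i = {min (T a) (T b)..max (T a) (T b)}"
      using lap_Icc[OF i ii] .
    have sub: "i \<subseteq> {0..1}" using ab by auto
    have "continuous_on i (h i)"
      unfolding h_def using maps_unit sub
      by (intro continuous_intros continuous_on_compose2[OF F'(1)] continuous_on_subset[OF cont]) auto
    moreover have "mono_on i (h i)"
    proof (rule mono_onI)
      fix x y assume xy: "x \<in> i" "y \<in> i" "x \<le> y"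
      then have unit: "T x \<in> {0..1}" "T y \<in> {0..1}"
        using sub maps_unit by blast+
      show "h i x \<le> h i y"
      proof (cases "mono_on i T")
        case True
        then have "F (T x) \<le> F (T y)"
          using xy unit by (intro mono_onD[OF F'(2)]) (auto dest: mono_onD)
        then show ?thesis
          using True \<open>lam > 0\<close> by (simp add: h_def s_def divide_right_mono)
      next
        case False
        then have "antimono_on i T"
          using lap_monotone[OF ii] by (simp add: monotone_map_on_def)
        then have "F (T y) \<le> F (T x)"
          using xy unit by (intro mono_onD[OF F'(2)]) (auto dest: monotone_onD)
        then show ?thesis
          using False \<open>lam > 0\<close> by (simp add: h_def s_def divide_right_mono)
      qed
    qed
    moreover have "increment (h i) i = u i"
    proof -
      \<comment> \<open>The image of \<open>i\<close> is tiled by elements \<open>j\<close> with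
        increments \<open>u j\<close>, so the row equation evaluates the increment of
        \<open>F\<close> over it as \<open>lam * u i\<close>.\<close>
      have "(increment F has_sum increment F (T ` i)) {j \<in> Q. j \<subseteq> T ` i}"
        using i ii F'(1,2) by (rule increment_lap_image)
      then have "(u has_sum increment F (T ` i)) {j \<in> Q. j \<subseteq> T ` i}"
        by (rule iffD2[OF has_sum_cong, rotated]) (use F'(3) in auto)
      then have "increment F (T ` i) = lam * u i"
        using classical_row[OF cls i u] has_sum_unique by blast
      moreover have "increment (h i) i = increment F (T ` i) / lam"
      proof (cases "mono_on i T")
        case True
        then have "T a \<le> T b" using mono_onD[OF True, of a b] ab by auto
        then show ?thesis
          using True ab by (simp add: h_def s_def diff_divide_distrib)
      next
        case False
        then have "antimono_on i T"
          using lap_monotone[OF ii] by (simp add: monotone_map_on_def)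
        then have "T b \<le> T a" using monotone_onD[of i "(\<le>)" "(\<ge>)" T a b] ab by auto
        then show ?thesis
          using False ab by (simp add: h_def s_def diff_divide_distrib)
      qed
      ultimately show ?thesis using \<open>lam > 0\<close> by simp
    qed
    ultimately show ?thesis by blast
  qed
  have "(\<lambda>i. increment (h i) i) summable_on Q"
    using summ by (rule iffD2[OF summable_on_cong, rotated]) (use * in auto)
  from tiling_glue[OF tiling zero_le_one _ _ this] *
  obtain G where G: "continuous_on {0..1} G" "mono_on {0..1} G" "G 0 = 0"
    "\<And>i x y. i \<in> Q \<Longrightarrow> x \<in> i \<Longrightarrow> y \<in> i \<Longrightarrow> G y - G x = h i y - h i x"
    by blast
  have "increment G i = u i" if i: "i \<in> Q" for i
  proof -
    obtain a b where "a < b" "i = {a..b}"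
      using tiling i by (rule interval_tiling_Icc)
    then show ?thesis using G(4)[OF i, of a b] *[OF i] by simp
  qed
  moreover have "G y - G x = s i * (F (T y) - F (T x))" if "i \<in> Q" "x \<in> i" "y \<in> i" for i x y
    using G(4)[OF that] by (simp add: h_def right_diff_distrib)
  ultimately show ?thesis
    using G(1-3) unfolding solution_map_def by blast
qed

text \<open>A starting point for the iteration: the affine function with increment
  \<open>u i\<close> on each element.\<close>

lemma solution_map_exists:
  assumes u: "positive_summable_solution Q m lam u"
  shows "\<exists>F. solution_map u F"
proof -
  note pos = positive_summable_solutionD(1)[OF u]
  note summ = positive_summable_solutionD(2)[OF u]
  define h where "h i x = u i * ((x - Inf i) / (Sup i - Inf i))" for i and x :: real
  have *: "continuous_on i (h i) \<and> mono_on i (h i) \<and> increment (h i) i = u i" if i: "i \<in> Q" for i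
  proof -
    obtain a b where ab: "a < b" "i = {a..b}"
      using tiling i by (rule interval_tiling_Icc)
    have "continuous_on i (h i)"
      unfolding h_def by (cases "Sup i = Inf i") (auto intro!: continuous_intros)
    moreover have "mono_on i (h i)"
      using pos[OF i] ab unfolding h_def
      by (intro mono_onI mult_left_mono divide_right_mono) auto
    moreover have "increment (h i) i = u i"
      using ab by (simp add: h_def)
    ultimately show ?thesis by blast
  qed
  have "(\<lambda>i. increment (h i) i) summable_on Q"
    using summ by (rule iffD2[OF summable_on_cong, rotated]) (use * in auto)
  from tiling_glue[OF tiling zero_le_one _ _ this] *
  obtain G where G: "continuous_on {0..1} G" "mono_on {0..1} G" "G 0 = 0"
    "\<And>i x y. i \<in> Q \<Longrightarrow> x \<in> i \<Longrightarrow> y \<in> i \<Longrightarrow> G y - G x = h i y - h i x"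
    by blast
  have "increment G i = u i" if i: "i \<in> Q" for i
  proof -
    obtain a b where "a < b" "i = {a..b}"
      using tiling i by (rule interval_tiling_Icc)
    then show ?thesis using G(4)[OF i, of a b] *[OF i] by simp
  qed
  then show ?thesis
    using G(1-3) unfolding solution_map_def by blast
qed

text \<open>Successive iterates differ by at most a geometric sequence of ratio
  \<open>1 / lam\<close>, so they converge uniformly, and the functional equation passes to the
  limit.\<close>

lemma solution_map_fixed_point:
  assumes cls: "classical_markov_partition T Q" and "lam > 1"
    and u: "positive_summable_solution Q (transition_matrix T) lam u"
  obtains F where "solution_map u F"
    "\<And>i x y. i \<in> Q \<Longrightarrow> x \<in> i \<Longrightarrow> y \<in> i \<Longrightarrow>
       F (T y) - F (T x) = (if mono_on i T then lam else - lam) * (F y - F x)"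
proof -
  have "lam > 0" using \<open>lam > 1\<close> by simp
  define s where "s i = (if mono_on i T then 1 / lam else - 1 / lam)" for i
  \<comment> \<open>The operator is given by an existence statement, so its orbit is built by
    dependent choice.\<close>
  have "\<exists>f. \<forall>n. solution_map u (f n) \<and>
    (\<forall>i\<in>Q. \<forall>x\<in>i. \<forall>y\<in>i. f (Suc n) y - f (Suc n) x = s i * (f n (T y) - f n (T x)))"
    using solution_map_exists[OF u] solution_map_iterate[OF cls \<open>lam > 0\<close> u]
    unfolding s_def by (intro dependent_nat_choice) auto
  then obtain f where f: "\<And>n. solution_map u (f n)"
    and f_Suc: "\<And>n i x y. i \<in> Q \<Longrightarrow> x \<in> i \<Longrightarrow> y \<in> i \<Longrightarrow>
      f (Suc n) y - f (Suc n) x = s i * (f n (T y) - f n (T x))"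
    by blast
  have f_cont: "continuous_on {0..1} (f n)" and f_mono: "mono_on {0..1} (f n)"
    and f_0: "f n 0 = 0" and f_inc: "i \<in> Q \<Longrightarrow> increment (f n) i = u i" for n i
    using f[of n] by (auto simp: solution_map_def)
  have f_eq: "f m c = f n c" if "c \<in> {0..1}" "\<And>j. j \<in> Q \<Longrightarrow> c \<notin> interior j" for m n c
    by (rule value_eq_if_increments_eq[OF f_cont f_mono f_0 f_cont f_mono f_0 _ that])
      (simp_all add: f_inc)
  define U where "U = f 0 1"
  have f_1: "f n 1 = U" for n
    unfolding U_def
  proof (rule f_eq)
    fix j assume j: "j \<in> Q"
    obtain p q where "p < q" "j = {p..q}" "q \<le> 1"
      using tiling j by (rule interval_tiling_Icc)
    then show "1 \<notin> interior j" by simp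
  qed auto
  \<comment> \<open>All iterates take values between \<open>0\<close> and their common value
    \<open>U\<close> at \<open>1\<close>, which bounds the first difference.\<close>
  have dist_le: "\<bar>f (Suc n) x - f n x\<bar> \<le> (1 / lam) ^ n * U" if "x \<in> {0..1}" for n x
    using that
  proof (induction n arbitrary: x)
    case 0
    have "0 \<le> f n x" "f n x \<le> U" for n
      using mono_onD[OF f_mono[of n], of 0 x] mono_onD[OF f_mono[of n], of x 1] 0
      by (auto simp: f_0 f_1)
    from this[of 0] this[of "Suc 0"] show ?case by simp
  next
    case (Suc n)
    have "0 \<le> U"
      using mono_onD[OF f_mono[of 0], of 0 1] by (simp add: f_0 f_1)
    show ?case
    proof (cases "\<exists>i\<in>Q. x \<in> interior i")
      case False
      then have "f (Suc (Suc n)) x = f (Suc n) x"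
        using Suc.prems by (intro f_eq) auto
      then show ?thesis
        using \<open>0 \<le> U\<close> \<open>lam > 0\<close> by simp
    next
      case True
      then obtain i where i: "i \<in> Q" "x \<in> interior i" by blast
      have ii: "i \<in> laps T i" using classical_laps[OF cls i(1)] by simp
      obtain a b where ab: "a < b" "i = {a..b}" "0 \<le> a" "b \<le> 1"
        "T ` i = {min (T a) (T b)..max (T a) (T b)}"
        using lap_Icc[OF i(1) ii] .
      have x: "a \<in> i" "x \<in> i" using ab i(2) by auto
      \<comment> \<open>The functional equations are anchored at the left end point \<open>a\<close>
        of \<open>i\<close>. Since \<open>a\<close> and \<open>T a\<close> lie in no interior,
        consecutive iterates agree there, and only the difference at \<open>T x\<close> remains,
        scaled by \<open>1 / lam\<close>.\<close>
      have "f (Suc (Suc n)) a = f (Suc n) a"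
        using ab endpoint_not_interior[of a b] i(1) by (intro f_eq) auto
      moreover have "T a = min (T a) (T b) \<or> T a = max (T a) (T b)" by linarith
      then have "T a \<notin> interior j" if "j \<in> Q" for j
        using lap_image_endpoints[OF i(1) ii ab(5) _ that] by (metis max.cobounded1 min.coboundedI1)
      then have "f (Suc n) (T a) = f n (T a)"
        using ab maps_unit[of a] by (intro f_eq) auto
      ultimately have "f (Suc (Suc n)) x - f (Suc n) x = s i * (f (Suc n) (T x) - f n (T x))"
        using f_Suc[OF i(1) x, of "Suc n"] f_Suc[OF i(1) x, of n] by (simp add: algebra_simps)
      then have "\<bar>f (Suc (Suc n)) x - f (Suc n) x\<bar> = (1 / lam) * \<bar>f (Suc n) (T x) - f n (T x)\<bar>"
        using \<open>lam > 0\<close> by (simp add: s_def abs_mult)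
      also have "\<dots> \<le> (1 / lam) * ((1 / lam) ^ n * U)"
        using Suc.prems maps_unit \<open>lam > 0\<close> by (intro mult_left_mono Suc.IH) auto
      finally show ?thesis by simp
    qed
  qed
  \<comment> \<open>The limit is written as a telescoping series, so that the Weierstrass test gives
    uniform convergence.\<close>
  define g where "g n x = f (Suc n) x - f n x" for n x
  define F where "F x = f 0 x + (\<Sum>n. g n x)" for x
  have sum_g: "(\<Sum>k<n. g k x) = f n x - f 0 x" for n x
    unfolding g_def by (rule sum_lessThan_telescope)
  have "summable (\<lambda>n. (1 / lam) ^ n * U)"
    using \<open>lam > 1\<close> by (intro summable_mult2 summable_geometric) simp
  then have unif: "uniform_limit {0..1} (\<lambda>n x. \<Sum>k<n. g k x) (\<lambda>x. \<Sum>k. g k x) sequentially"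
    using dist_le by (intro Weierstrass_m_test) (auto simp: g_def)
  have lim: "(\<lambda>n. f n x) \<longlonglongrightarrow> F x" if "x \<in> {0..1}" for x
    using tendsto_add[OF tendsto_const[of "f 0 x"] tendsto_uniform_limitI[OF unif that]]
    by (simp add: sum_g F_def)
  have "continuous_on {0..1} (\<lambda>x. \<Sum>k. g k x)"
    using unif by (rule uniform_limit_theorem[rotated])
      (auto simp: g_def intro!: always_eventually continuous_intros f_cont)
  then have "continuous_on {0..1} F"
    unfolding F_def by (intro continuous_intros f_cont)
  moreover have "mono_on {0..1} F"
  proof (rule mono_onI)
    fix x y :: real assume "x \<in> {0..1}" "y \<in> {0..1}" "x \<le> y"
    then show "F x \<le> F y"
      using mono_onD[OF f_mono] by (intro LIMSEQ_le[OF lim lim]) auto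
  qed
  moreover have "F 0 = 0"
    using LIMSEQ_unique[OF lim[of 0]] by (simp add: f_0)
  moreover have "increment F i = u i" if i: "i \<in> Q" for i
  proof -
    obtain a b where ab: "a < b" "i = {a..b}" "0 \<le> a" "b \<le> 1"
      using tiling i by (rule interval_tiling_Icc)
    then have "(\<lambda>n. f n b - f n a) \<longlonglongrightarrow> F b - F a"
      by (intro tendsto_diff lim) auto
    moreover have "f n b - f n a = u i" for n
      using f_inc[OF i, of n] ab by simp
    ultimately show ?thesis
      using ab LIMSEQ_unique[of "\<lambda>_. u i"] by fastforce
  qed
  ultimately have "solution_map u F"
    by (simp add: solution_map_def)
  moreover have "F (T y) - F (T x) = (if mono_on i T then lam else - lam) * (F y - F x)"
    if i: "i \<in> Q" and xy: "x \<in> i" "y \<in> i" for i x y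
  proof -
    have "i \<subseteq> {0..1}"
      using tiling i unfolding interval_tiling_def by blast
    then have unit: "x \<in> {0..1}" "y \<in> {0..1}" "T x \<in> {0..1}" "T y \<in> {0..1}"
      using xy maps_unit by blast+
    have "(\<lambda>n. f (Suc n) y - f (Suc n) x) \<longlonglongrightarrow> F y - F x"
      using unit by (intro tendsto_diff LIMSEQ_Suc lim)
    moreover have "(\<lambda>n. s i * (f n (T y) - f n (T x))) \<longlonglongrightarrow> s i * (F (T y) - F (T x))"
      using unit by (intro tendsto_mult tendsto_const tendsto_diff lim)
    ultimately have "F y - F x = s i * (F (T y) - F (T x))"
      using f_Suc[OF i xy] LIMSEQ_unique by simp
    then show ?thesis
      using \<open>lam > 0\<close> by (simp add: s_def)
  qed
  ultimately show ?thesis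
    using that by blast
qed

end

subsection \<open>Transfer along a conjugacy\<close>

text \<open>About \<open>S\<close> only the conjugacy is assumed, so the results are available while
  membership of \<open>S\<close> in \<open>CPMM\<close> is still to be shown.\<close>

locale unit_conjugacy =
  fixes \<psi> T S :: "real \<Rightarrow> real"
  assumes conj: "conjugate_via \<psi> T S" and T_maps: "T ` {0..1} \<subseteq> {0..1}"
begin

lemma \<psi>_cont: "continuous_on {0..1} \<psi>"
  and \<psi>_strict: "strict_mono_on {0..1} \<psi>"
  and \<psi>_onto: "\<psi> ` {0..1} = {0..1}"
  and \<psi>_T: "x \<in> {0..1} \<Longrightarrow> \<psi> (T x) = S (\<psi> x)"
  using conj by (auto simp: conjugate_via_def)

lemma \<psi>_inj: "inj_on \<psi> {0..1}"
  using \<psi>_strict by (rule strict_mono_on_imp_inj_on)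

lemma \<psi>_mono: "mono_on {0..1} \<psi>"
  using \<psi>_strict by (rule strict_mono_on_imp_mono_on)

lemma \<psi>_less: "x \<in> {0..1} \<Longrightarrow> y \<in> {0..1} \<Longrightarrow> x < y \<Longrightarrow> \<psi> x < \<psi> y"
  using \<psi>_strict by (rule strict_mono_onD)

lemma \<psi>_unit: "x \<in> {0..1} \<Longrightarrow> \<psi> x \<in> {0..1}"
  using \<psi>_onto by blast

lemma \<psi>_le_iff: "x \<in> {0..1} \<Longrightarrow> y \<in> {0..1} \<Longrightarrow> \<psi> x \<le> \<psi> y \<longleftrightarrow> x \<le> y"
  using \<psi>_less[of x y] \<psi>_less[of y x] by (cases x y rule: linorder_cases) auto

lemma image_Icc:
  assumes "0 \<le> a" "a \<le> b" "b \<le> 1"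
  shows "\<psi> ` {a..b} = {\<psi> a..\<psi> b}"
proof
  show "\<psi> ` {a..b} \<subseteq> {\<psi> a..\<psi> b}"
    using assms by (auto simp: \<psi>_le_iff)
  show "{\<psi> a..\<psi> b} \<subseteq> \<psi> ` {a..b}"
  proof
    fix y assume y: "y \<in> {\<psi> a..\<psi> b}"
    then have "y \<in> \<psi> ` {0..1}"
      using \<psi>_unit[of a] \<psi>_unit[of b] assms unfolding \<psi>_onto by auto
    then obtain x where x: "x \<in> {0..1}" "y = \<psi> x" by blast
    then have "x \<in> {a..b}"
      using y assms by (auto simp: \<psi>_le_iff)
    then show "y \<in> \<psi> ` {a..b}" using x by blast
  qed
qed

lemma iterate:
  assumes "x \<in> {0..1}"
  shows "(T ^^ n) x \<in> {0..1} \<and> \<psi> ((T ^^ n) x) = (S ^^ n) (\<psi> x)"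
proof (induction n)
  case (Suc n)
  then have "T ((T ^^ n) x) \<in> {0..1}"
    using T_maps by blast
  then show ?case
    using Suc by (simp add: \<psi>_T)
qed (use assms in simp)

lemma mixing_image:
  assumes "topologically_mixing T"
  shows "topologically_mixing S"
  unfolding topologically_mixing_def
proof (intro allI impI, elim conjE)
  fix U V :: "real set"
  assume U: "openin (top_of_set {0..1}) U" "U \<noteq> {}" and V: "openin (top_of_set {0..1}) V" "V \<noteq> {}"
  have pre: "openin (top_of_set {0..1}) ({0..1} \<inter> \<psi> -` W) \<and> {0..1} \<inter> \<psi> -` W \<noteq> {}"
    if W: "openin (top_of_set {0..1}) W" "W \<noteq> {}" for W
  proof
    show "openin (top_of_set {0..1}) ({0..1} \<inter> \<psi> -` W)"
      using \<psi>_cont _ W(1) by (rule continuous_openin_preimage) (use \<psi>_unit in auto)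
    have "W \<subseteq> \<psi> ` {0..1}"
      unfolding \<psi>_onto using W(1) by (rule openin_imp_subset)
    then show "{0..1} \<inter> \<psi> -` W \<noteq> {}"
      using W(2) by blast
  qed
  then obtain n where n: "\<And>m. m \<ge> n \<Longrightarrow> (T ^^ m) ` ({0..1} \<inter> \<psi> -` U) \<inter> ({0..1} \<inter> \<psi> -` V) \<noteq> {}"
    using assms U V unfolding topologically_mixing_def by meson
  have "(S ^^ m) ` U \<inter> V \<noteq> {}" if m: "m \<ge> n" for m
  proof -
    obtain x where x: "x \<in> {0..1}" "\<psi> x \<in> U" "\<psi> ((T ^^ m) x) \<in> V"
      using n[OF m] by blast
    then have "(S ^^ m) (\<psi> x) \<in> (S ^^ m) ` U \<inter> V"
      using iterate[OF x(1), of m] by simp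
    then show ?thesis by blast
  qed
  then show "\<exists>n. \<forall>m\<ge>n. (S ^^ m) ` U \<inter> V \<noteq> {}"
    by blast
qed

text \<open>By uniform continuity of \<open>\<psi>\<close>, separated sets of \<open>S\<close> pull
  back to separated sets of \<open>T\<close> of the same cardinality at a scale depending only on
  \<open>\<epsilon>\<close>.\<close>

lemma entropy_image_le: "topological_entropy S \<le> topological_entropy T"
proof -
  define h where "h R \<epsilon> n = (SUP E\<in>{E. separated_set R n \<epsilon> E}. ereal (ln (real (card E)) / real n))"
    for R :: "real \<Rightarrow> real" and \<epsilon> n
  define g where "g = inv_into {0..1} \<psi>"
  have g: "g y \<in> {0..1}" "\<psi> (g y) = y" if "y \<in> {0..1}" for y
    using that inv_into_into[of y \<psi> "{0..1}"] f_inv_into_f[of y \<psi> "{0..1}"]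
    unfolding \<psi>_onto g_def by blast+
  have "limsup (h S \<epsilon>) \<le> topological_entropy T" if "\<epsilon> > 0" for \<epsilon>
  proof -
    have "uniformly_continuous_on {0..1} \<psi>"
      using \<psi>_cont by (intro compact_uniformly_continuous) auto
    then obtain \<delta> where \<delta>: "\<delta> > 0"
      "\<And>x y. x \<in> {0..1} \<Longrightarrow> y \<in> {0..1} \<Longrightarrow> dist y x < \<delta> \<Longrightarrow> dist (\<psi> y) (\<psi> x) < \<epsilon>"
      using \<open>\<epsilon> > 0\<close> unfolding uniformly_continuous_on_def by metis
    \<comment> \<open>Uniform continuity only excludes distances below \<open>\<delta>\<close>;
      passing to \<open>\<delta> / 2\<close> gives the strict inequality in
      \<open>separated_set\<close>.\<close>
    have sep: "separated_set T n (\<delta> / 2) (g ` E) \<and> card (g ` E) = card E"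
      if E: "separated_set S n \<epsilon> E" for n E
    proof
      have fin: "finite E" and sub: "E \<subseteq> {0..1}" and
        far: "\<And>x y. x \<in> E \<Longrightarrow> y \<in> E \<Longrightarrow> x \<noteq> y \<Longrightarrow> \<exists>k<n. dist ((S ^^ k) x) ((S ^^ k) y) > \<epsilon>"
        using E by (auto simp: separated_set_def)
      have "\<exists>k<n. dist ((T ^^ k) (g x)) ((T ^^ k) (g y)) > \<delta> / 2"
        if xy: "x \<in> E" "y \<in> E" "g x \<noteq> g y" for x y
      proof -
        obtain k where k: "k < n" "dist ((S ^^ k) x) ((S ^^ k) y) > \<epsilon>"
          using far[of x y] xy by blast
        have gx: "g x \<in> {0..1}" "g y \<in> {0..1}" "\<psi> (g x) = x" "\<psi> (g y) = y"
          using g xy sub by auto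
        have "\<not> dist ((T ^^ k) (g x)) ((T ^^ k) (g y)) < \<delta>"
          using \<delta>(2)[of "(T ^^ k) (g y)" "(T ^^ k) (g x)"] k(2) iterate[of "g x" k]
            iterate[of "g y" k] gx by auto
        then show ?thesis
          using k(1) \<delta>(1) by (intro exI[of _ k]) auto
      qed
      then show "separated_set T n (\<delta> / 2) (g ` E)"
        using fin sub g(1) unfolding separated_set_def by auto
      have "inj_on g E"
        using g(2) sub by (metis inj_onI subsetD)
      then show "card (g ` E) = card E"
        by (rule card_image)
    qed
    have "h S \<epsilon> n \<le> h T (\<delta> / 2) n" for n
      unfolding h_def
    proof (rule SUP_mono)
      fix E assume "E \<in> {E. separated_set S n \<epsilon> E}"
      then have "separated_set S n \<epsilon> E" by simp
      from sep[OF this]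
      show "\<exists>E'\<in>{E. separated_set T n (\<delta> / 2) E}.
        ereal (ln (real (card E)) / real n) \<le> ereal (ln (real (card E')) / real n)"
        by (intro bexI[of _ "g ` E"]) auto
    qed
    then have "limsup (h S \<epsilon>) \<le> limsup (h T (\<delta> / 2))"
      by (intro Limsup_mono always_eventually) blast
    also have "\<dots> \<le> topological_entropy T"
      unfolding topological_entropy_def h_def using \<delta>(1) by (intro SUP_upper) auto
    finally show ?thesis .
  qed
  then show ?thesis
    unfolding topological_entropy_def[of S] h_def by (intro SUP_least) auto
qed

end

text \<open>An increasing homeomorphism preserves order, interiors and countability. Every element
  of a classical partition is its own only lap, so the Markov property is checked on whole
  elements.\<close>

lemma (in slack_partition) classical_partition_image:
  assumes cls: "classical_markov_partition T Q" and conj: "conjugate_via \<psi> T S"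
  shows "classical_markov_partition S ((`) \<psi> ` Q)"
proof -
  interpret unit_conjugacy \<psi> T S
    using conj maps by unfold_locales
  have Icc: "\<exists>a b. 0 \<le> a \<and> a < b \<and> b \<le> 1 \<and> i = {a..b} \<and> \<psi> ` i = {\<psi> a..\<psi> b} \<and>
      \<psi> a < \<psi> b \<and> 0 \<le> \<psi> a \<and> \<psi> b \<le> 1 \<and> interior (\<psi> ` i) = \<psi> ` interior i"
    if i: "i \<in> Q" for i
  proof -
    obtain a b where ab: "a < b" "i = {a..b}" "0 \<le> a" "b \<le> 1"
      using tiling i by (rule interval_tiling_Icc)
    then have unit: "a \<in> {0..1}" "b \<in> {0..1}" by auto
    have im: "\<psi> ` {a..b} = {\<psi> a..\<psi> b}"
      using ab by (intro image_Icc) auto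
    have "{a..b} \<subseteq> {0..1}" using ab by auto
    then have "inj_on \<psi> {a..b}" using \<psi>_inj inj_on_subset by blast
    then have "\<psi> ` ({a..b} - {a, b}) = \<psi> ` {a..b} - \<psi> ` {a, b}"
      using ab by (intro inj_on_image_set_diff) auto
    also have "{a..b} - {a, b} = interior {a..b}"
      by auto
    also have "\<psi> ` {a..b} - \<psi> ` {a, b} = interior (\<psi> ` {a..b})"
      unfolding im by auto
    finally show ?thesis
      using ab unit im \<psi>_less[of a b] \<psi>_unit[of a] \<psi>_unit[of b]
      by (intro exI[of _ a] exI[of _ b]) auto
  qed
  have sub: "i \<subseteq> {0..1}" if "i \<in> Q" for i
    using tiling that unfolding interval_tiling_def by blast
  have S_im: "S ` \<psi> ` i = \<psi> ` T ` i" if "i \<in> Q" for i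
    unfolding image_image using sub[OF that] by (intro image_cong refl) (metis \<psi>_T subsetD)
  have int: "interior (\<psi> ` i) = \<psi> ` interior i" if "i \<in> Q" for i
    using Icc[OF that] by metis
  have mono: "monotone_map_on S (\<psi> ` i)" if i: "i \<in> Q" for i
  proof -
    have "mono_on i T \<or> antimono_on i T"
      using cls i by (auto simp: classical_markov_partition_def monotone_map_on_def)
    moreover have unit: "x \<in> {0..1} \<and> T x \<in> {0..1}" if "x \<in> i" for x
      using sub[OF i] maps_unit that by blast
    then have "x \<le> y \<longleftrightarrow> \<psi> x \<le> \<psi> y" "T x \<le> T y \<longleftrightarrow> S (\<psi> x) \<le> S (\<psi> y)" if "x \<in> i" "y \<in> i" for x y
      using that \<psi>_le_iff \<psi>_T by metis+
    ultimately show ?thesis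
      unfolding monotone_map_on_def monotone_on_def by auto
  qed
  have "countable ((`) \<psi> ` Q)"
    using interval_tilingD(1)[OF tiling] by simp
  moreover have "\<forall>k\<in>(`) \<psi> ` Q. \<exists>a b. 0 \<le> a \<and> a < b \<and> b \<le> 1 \<and> k = {a..b}"
  proof
    fix k assume "k \<in> (`) \<psi> ` Q"
    then obtain i where "i \<in> Q" "k = \<psi> ` i" by blast
    then show "\<exists>a b. 0 \<le> a \<and> a < b \<and> b \<le> 1 \<and> k = {a..b}"
      using Icc[of i] by metis
  qed
  moreover have "pairwise (\<lambda>i j. interior i \<inter> interior j = {}) ((`) \<psi> ` Q)"
  proof (rule pairwiseI)
    fix k l assume "k \<in> (`) \<psi> ` Q" "l \<in> (`) \<psi> ` Q" "k \<noteq> l"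
    then obtain i j where ij: "i \<in> Q" "j \<in> Q" "k = \<psi> ` i" "l = \<psi> ` j" "i \<noteq> j" by blast
    have "interior i \<inter> interior j = {}"
      using interval_tiling_interior[OF tiling] ij by blast
    moreover have "interior i \<subseteq> {0..1}" "interior j \<subseteq> {0..1}"
      using sub ij interior_subset by blast+
    ultimately have "\<psi> ` interior i \<inter> \<psi> ` interior j = {}"
      using inj_on_image_Int[OF \<psi>_inj, of "interior i" "interior j"] by simp
    then show "interior k \<inter> interior l = {}"
      using int ij by simp
  qed
  moreover have "{0..1} - \<Union>((`) \<psi> ` Q) \<subseteq> \<psi> ` ({0..1} - \<Union>Q)"
  proof
    fix y assume y: "y \<in> {0..1} - \<Union>((`) \<psi> ` Q)"
    then have "y \<in> \<psi> ` {0..1}" by (simp only: \<psi>_onto Diff_iff)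
    then show "y \<in> \<psi> ` ({0..1} - \<Union>Q)" using y by blast
  qed
  then have "countable ({0..1} - \<Union>((`) \<psi> ` Q))"
    using interval_tilingD(2)[OF tiling] by (meson countable_image countable_subset)
  moreover have "\<psi> ` j \<subseteq> S ` K"
    if i: "i \<in> Q" and j: "j \<in> Q" and K: "maximal_monotone_interval S (\<psi> ` i) K"
      and meet: "S ` K \<inter> interior (\<psi> ` j) \<noteq> {}" for i j K
  proof -
    obtain a b where ab: "\<psi> ` i = {a..b}" "a < b" using Icc[OF i] by metis
    then have "K = \<psi> ` i"
      using laps_monotone[of S a b] mono[OF i] K by (auto simp: laps_def)
    then have SK: "S ` K = \<psi> ` T ` i" using S_im[OF i] by simp
    then obtain x y where xy: "x \<in> T ` i" "y \<in> interior j" "\<psi> x = \<psi> y"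
      using meet unfolding int[OF j] SK by blast
    have "x \<in> {0..1}"
      using xy(1) maps sub[OF i] by blast
    moreover have "y \<in> {0..1}"
      using xy(2) sub[OF j] interior_subset by blast
    ultimately have "x = y"
      using xy(3) \<psi>_inj by (auto dest: inj_onD)
    then have "T ` i \<inter> interior j \<noteq> {}"
      using xy(1,2) by blast
    then have "j \<subseteq> T ` i"
      using markov[OF i j] classical_laps[OF cls i] by simp
    then show ?thesis unfolding SK by blast
  qed
  then have "\<forall>i\<in>(`) \<psi> ` Q. \<forall>j\<in>(`) \<psi> ` Q. \<forall>K. maximal_monotone_interval S i K \<longrightarrow>
      S ` K \<inter> interior j \<noteq> {} \<longrightarrow> j \<subseteq> S ` K"
    by blast
  moreover have "\<forall>i\<in>(`) \<psi> ` Q. monotone_map_on S i"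
    using mono by blast
  ultimately show ?thesis
    unfolding classical_markov_partition_def markov_collection_def by (intro conjI)
qed

section \<open>Invariance of \<open>CPMM\<close> under conjugacy\<close>

lemma CPMM_slack_partition:
  assumes "T \<in> CPMM" "slack_markov_partition T Q"
  shows "slack_partition T Q"
  using assms topologically_mixing_nowhere_constant[of T]
  by unfold_locales (auto simp: CPMM_def interval_map_def)

text \<open>A member of \<open>CPMM\<close> may come with a slack partition only, while partitions
  are transported along conjugacies in classical form; the refinement by laps bridges the
  two.\<close>

lemma CPMM_infinite_classical:
  assumes "T \<in> CPMM"
  shows "\<exists>P. infinite P \<and> classical_markov_partition T P"
proof -
  obtain Q where Q: "infinite Q" "slack_markov_partition T Q"
    using assms classical_imp_slack by (auto simp: CPMM_def)
  interpret slack_partition T Q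
    using assms Q(2) by (rule CPMM_slack_partition)
  show ?thesis
    using refinement_infinite[OF Q(1)] refinement_classical by blast
qed

lemma CPMM_image:
  assumes T: "T \<in> CPMM" and conj: "conjugate_via \<psi> T S" and S: "continuous_on {0..1} S"
  shows "S \<in> CPMM"
proof -
  have T_maps: "T ` {0..1} \<subseteq> {0..1}" and mix: "topologically_mixing T"
    and ent: "topological_entropy T < \<infinity>"
    using T by (auto simp: CPMM_def interval_map_def)
  interpret unit_conjugacy \<psi> T S
    using conj T_maps by unfold_locales
  obtain P where P: "infinite P" "classical_markov_partition T P"
    using CPMM_infinite_classical[OF T] by blast
  interpret slack_partition T P
    using T classical_imp_slack[OF P(2)] by (rule CPMM_slack_partition)
  have "inj_on ((`) \<psi>) P"
  proof (rule inj_onI)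
    fix i j assume ij: "i \<in> P" "j \<in> P" "\<psi> ` i = \<psi> ` j"
    then have "i \<subseteq> {0..1}" "j \<subseteq> {0..1}"
      using tiling unfolding interval_tiling_def by blast+
    then show "i = j"
      using ij(3) inj_on_image_eq_iff[OF \<psi>_inj] by blast
  qed
  then have "infinite ((`) \<psi> ` P)"
    using P(1) finite_imageD by blast
  moreover have "classical_markov_partition S ((`) \<psi> ` P)"
    using P(2) conj by (rule classical_partition_image)
  moreover have "S ` {0..1} \<subseteq> {0..1}"
  proof
    fix y assume "y \<in> S ` {0..1}"
    then obtain x where x: "x \<in> {0..1}" "y = S (\<psi> x)"
      using \<psi>_onto by (metis imageE)
    then show "y \<in> {0..1}"
      using \<psi>_unit[OF maps_unit[OF x(1)]] by (simp add: \<psi>_T)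
  qed
  ultimately show ?thesis
    unfolding CPMM_def interval_map_def
    using S mixing_image[OF mix] entropy_image_le ent by (auto intro: order_le_less_trans)
qed

subsection \<open>The equivalences\<close>

text \<open>Monotonicity fixes the sign of the derivative, which is therefore constantly
  \<open>lam\<close> or constantly \<open>- lam\<close> off a countable set.\<close>

lemma increment_monotone_constant_slope:
  assumes "constant_slope lam S" "lam > 0" and S: "continuous_on {0..1} S"
    and cd: "0 \<le> c" "c < d" "d \<le> 1" and mono: "monotone_map_on S {c..d}"
  shows "\<bar>S d - S c\<bar> = lam * (d - c)"
proof -
  define E where "E = {x \<in> {0..1}.
       \<not> (\<exists>D. (S has_real_derivative D) (at x within {0..1}) \<and> \<bar>D\<bar> = lam)}"
  have "countable E"
    using assms(1) by (simp add: E_def constant_slope_def)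
  have cont: "continuous_on {c..d} S"
    using cd by (intro continuous_on_subset[OF S]) auto
  have der: "\<exists>D. (S has_real_derivative D) (at x) \<and> \<bar>D\<bar> = lam" if x: "x \<in> {c<..<d} - E" for x
  proof -
    have "x \<in> interior {0..1}" "x \<in> {0..1}" using x cd by auto
    then show ?thesis
      using x at_within_interior[of x "{0..1}"] by (auto simp: E_def)
  qed
  show ?thesis
  proof (cases "mono_on {c..d} S")
    case True
    have "(S has_real_derivative lam) (at x)" if x: "x \<in> {c<..<d} - E" for x
    proof -
      obtain D where D: "(S has_real_derivative D) (at x)" "\<bar>D\<bar> = lam"
        using der[OF x] by blast
      have "D \<ge> 0"
        using True D(1) by (rule mono_on_imp_deriv_nonneg) (use x in auto)
      then show ?thesis using D by simp
    qed
    then have "S d - S c = lam * (d - c)"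
      using cd cont \<open>countable E\<close> by (intro constant_derivative_except_countable[where E = E]) auto
    then show ?thesis using cd \<open>lam > 0\<close> by simp
  next
    case False
    then have anti: "mono_on {c..d} (\<lambda>x. - S x)"
      using mono by (simp add: monotone_map_on_def antimono_on_iff_mono_on_minus)
    have "((\<lambda>x. - S x) has_real_derivative lam) (at x)" if x: "x \<in> {c<..<d} - E" for x
    proof -
      obtain D where D: "(S has_real_derivative D) (at x)" "\<bar>D\<bar> = lam"
        using der[OF x] by blast
      have D': "((\<lambda>x. - S x) has_real_derivative - D) (at x)"
        using D(1) by (rule DERIV_minus)
      have "- D \<ge> 0"
        using anti D' by (rule mono_on_imp_deriv_nonneg) (use x in auto)
      then have "- D = lam" using D(2) by simp
      then show ?thesis using D' by simp
    qed
    then have "- S d - - S c = lam * (d - c)"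
      using cd cont \<open>countable E\<close>
      by (intro constant_derivative_except_countable[where E = E]) (auto intro: continuous_on_minus)
    then show ?thesis using cd \<open>lam > 0\<close> mult_pos_pos[of lam "d - c"] by linarith
  qed
qed

text \<open>The argument treats slack partitions directly, lap by lap, and so covers classical ones
  as well.\<close>

lemma (in slack_partition) conjugate_imp_solution:
  assumes S: "S \<in> CPMM_slope lam" and conj: "conjugate_via \<psi> T S" and "lam > 0"
  shows "positive_summable_solution Q (transition_matrix T) lam (increment \<psi>)"
proof -
  interpret unit_conjugacy \<psi> T S
    using conj maps by unfold_locales
  have S': "continuous_on {0..1} S" "constant_slope lam S"
    using S by (auto simp: CPMM_slope_def CPMM_def interval_map_def)
  have pos: "0 < increment \<psi> i" if i: "i \<in> Q" for i
  proof -
    obtain a b where ab: "a < b" "i = {a..b}" "0 \<le> a" "b \<le> 1"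
      using tiling i by (rule interval_tiling_Icc)
    then show ?thesis using \<psi>_less[of a b] by simp
  qed
  \<comment> \<open>\<open>\<psi>\<close> carries \<open>T\<close> on \<open>K\<close> to a monotone
    branch of \<open>S\<close>, and the constant slope multiplies its length by
    \<open>lam\<close>.\<close>
  have lap: "increment \<psi> (T ` K) = lam * increment \<psi> K" if i: "i \<in> Q" and K: "K \<in> laps T i" for i K
  proof -
    obtain c d where cd: "c < d" "K = {c..d}" "0 \<le> c" "d \<le> 1" "T c \<noteq> T d"
      "T ` K = {min (T c) (T d)..max (T c) (T d)}"
      using lap_Icc[OF i K] .
    have cd01: "c \<in> {0..1}" "d \<in> {0..1}" using cd by auto
    have im: "\<psi> ` {c..d} = {\<psi> c..\<psi> d}"
      using cd by (intro image_Icc) auto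
    have "x \<in> {0..1} \<and> T x \<in> {0..1}" if "x \<in> K" for x
      using maps_unit[of x] cd that by auto
    then have "x \<le> y \<longleftrightarrow> \<psi> x \<le> \<psi> y" "T x \<le> T y \<longleftrightarrow> S (\<psi> x) \<le> S (\<psi> y)" if "x \<in> K" "y \<in> K" for x y
      using that \<psi>_le_iff \<psi>_T by metis+
    moreover have "mono_on K T \<or> antimono_on K T"
      using lap_monotone[OF K] by (simp add: monotone_map_on_def)
    ultimately have "monotone_map_on S (\<psi> ` K)"
      unfolding monotone_map_on_def monotone_on_def by auto
    then have "\<bar>S (\<psi> d) - S (\<psi> c)\<bar> = lam * (\<psi> d - \<psi> c)"
      using \<psi>_less[OF cd01 cd(1)] \<psi>_unit[OF cd01(1)] \<psi>_unit[OF cd01(2)]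
      by (intro increment_monotone_constant_slope[OF S'(2) \<open>lam > 0\<close> S'(1)]) (auto simp: cd(2) im)
    then have "\<bar>\<psi> (T d) - \<psi> (T c)\<bar> = lam * increment \<psi> K"
      using cd cd01 by (simp add: \<psi>_T)
    moreover have "increment \<psi> (T ` K) = \<bar>\<psi> (T d) - \<psi> (T c)\<bar>"
      using mono_onD[OF \<psi>_mono maps_unit[OF cd01(1)] maps_unit[OF cd01(2)]]
        mono_onD[OF \<psi>_mono maps_unit[OF cd01(2)] maps_unit[OF cd01(1)]]
      unfolding cd(6) by (cases "T c \<le> T d") (auto simp: min_def max_def)
    ultimately show ?thesis by simp
  qed
  have row: "((\<lambda>j. real (transition_matrix T i j) * increment \<psi> j) has_sum (lam * increment \<psi> i)) Q"
    if i: "i \<in> Q" for i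
  proof -
    obtain a b where ab: "a < b" "i = {a..b}" "0 \<le> a" "b \<le> 1"
      using tiling i by (rule interval_tiling_Icc)
    have sub: "{a..b} \<subseteq> {0..1}" using ab by auto
    have "interval_tiling (laps T i) {a..b}"
      using laps_tiling(2)[OF i] ab(2) by simp
    then have "(increment \<psi> has_sum (\<psi> b - \<psi> a)) (laps T i)"
      by (rule increment_has_sum)
        (use ab(1) continuous_on_subset[OF \<psi>_cont sub] mono_on_subset[OF \<psi>_mono sub] in auto)
    then have "(\<Sum>K\<in>laps T i. increment \<psi> K) = increment \<psi> i"
      using laps_tiling(1)[OF i] ab by (simp add: has_sum_finite_iff)
    then have "(\<Sum>K\<in>laps T i. increment \<psi> (T ` K)) = lam * increment \<psi> i"
      using lap[OF i] by (simp flip: sum_distrib_left)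
    moreover have "((\<lambda>j. real (transition_matrix T i j) * increment \<psi> j) has_sum
        (\<Sum>K\<in>laps T i. increment \<psi> (T ` K))) Q"
      by (intro transition_matrix_row[OF i] increment_lap_image[OF i] \<psi>_cont \<psi>_mono)
    ultimately show ?thesis by simp
  qed
  have "(increment \<psi> has_sum (\<psi> 1 - \<psi> 0)) Q"
    using tiling zero_le_one \<psi>_cont \<psi>_mono by (rule increment_has_sum)
  then have "increment \<psi> summable_on Q"
    by (rule has_sum_imp_summable)
  then have "(\<lambda>i. \<bar>increment \<psi> i\<bar>) summable_on Q"
    by (rule iffD2[OF summable_on_cong, rotated]) (use pos in \<open>auto simp: less_imp_le\<close>)
  moreover have "\<exists>i\<in>Q. increment \<psi> i \<noteq> 0"
    using interval_tiling_meets[OF tiling, of 0 1] pos by force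
  ultimately show ?thesis
    using pos row less_imp_le unfolding positive_summable_solution_def lambda_solution_def by blast
qed

lemma (in slack_partition) solution_imp_conjugate:
  assumes T: "T \<in> CPMM" and cls: "classical_markov_partition T Q" and "lam > 1"
    and u: "positive_summable_solution Q (transition_matrix T) lam u"
  shows "\<exists>\<psi>. \<exists>S\<in>CPMM_slope lam. conjugate_via \<psi> T S"
proof -
  obtain F where F: "solution_map u F"
    and F_T: "\<And>i x y. i \<in> Q \<Longrightarrow> x \<in> i \<Longrightarrow> y \<in> i \<Longrightarrow>
       F (T y) - F (T x) = (if mono_on i T then lam else - lam) * (F y - F x)"
    using solution_map_fixed_point[OF cls \<open>lam > 1\<close> u] by blast
  have F': "continuous_on {0..1} F" "mono_on {0..1} F" "F 0 = 0"
    "\<And>i. i \<in> Q \<Longrightarrow> increment F i = u i"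
    using F by (auto simp: solution_map_def)
  obtain i0 where i0: "i0 \<in> Q"
    using u by (auto simp: positive_summable_solution_def lambda_solution_def)
  have "F 1 > 0"
  proof -
    obtain a b where ab: "a < b" "i0 = {a..b}" "0 \<le> a" "b \<le> 1"
      using tiling i0 by (rule interval_tiling_Icc)
    have "0 < F b - F a"
      using F'(4)[OF i0] positive_summable_solutionD(1)[OF u i0] ab by simp
    moreover have "F 0 \<le> F a" "F b \<le> F 1"
      using ab by (auto intro!: mono_onD[OF F'(2)])
    ultimately show ?thesis using F'(3) by simp
  qed
  have strict: "strict_mono_on {0..1} F"
  proof (rule strict_mono_on_if_mixing[OF _ cont maps tiling F'(1,2)])
    show "topologically_mixing T" using T by (simp add: CPMM_def)
    show "F 0 \<noteq> F 1" using \<open>F 1 > 0\<close> F'(3) by simp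
    show "F (T x) = F (T y)" if "i \<in> Q" "x \<in> i" "y \<in> i" "F x = F y" for i x y
      using F_T[OF that(1-3)] that(4) by simp
  qed
  \<comment> \<open>Division by the total increment makes \<open>\<psi>\<close> onto
    \<open>{0..1}\<close>. The functional equation is linear in \<open>F\<close>, so it survives the
    rescaling.\<close>
  define \<psi> where "\<psi> x = F x / F 1" for x
  have \<psi>: "continuous_on {0..1} \<psi>" "strict_mono_on {0..1} \<psi>" "\<psi> 0 = 0" "\<psi> 1 = 1"
    using \<open>F 1 > 0\<close> strict F'(3) unfolding \<psi>_def
    by (auto intro!: continuous_intros F'(1) strict_mono_onI divide_strict_right_mono
        dest: strict_mono_onD)
  have \<psi>_increment: "\<psi> (T y) - \<psi> (T x) = (if mono_on i T then lam else - lam) * (\<psi> y - \<psi> x)"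
    if "i \<in> Q" "x \<in> i" "y \<in> i" for i x y
    using F_T[OF that] unfolding \<psi>_def by (simp flip: diff_divide_distrib)
  have onto: "\<psi> ` {0..1} = {0..1}"
  proof
    show "\<psi> ` {0..1} \<subseteq> {0..1}"
      using mono_onD[OF strict_mono_on_imp_mono_on[OF \<psi>(2)], of 0]
        mono_onD[OF strict_mono_on_imp_mono_on[OF \<psi>(2)], of _ 1] \<psi>(3,4) by auto
    show "{0..1} \<subseteq> \<psi> ` {0..1}"
    proof
      fix y :: real assume "y \<in> {0..1}"
      then show "y \<in> \<psi> ` {0..1}"
        using IVT'[of \<psi> 0 y 1] \<psi> by auto
    qed
  qed
  have inj: "inj_on \<psi> {0..1}"
    using \<psi>(2) by (rule strict_mono_on_imp_inj_on)
  define g where "g = the_inv_into {0..1} \<psi>"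
  have g: "g (\<psi> x) = x" if "x \<in> {0..1}" for x
    unfolding g_def using inj that by (rule the_inv_into_f_f)
  define S where "S y = \<psi> (T (g y))" for y
  have conj: "conjugate_via \<psi> T S"
    using \<psi> onto g by (simp add: conjugate_via_def S_def)
  interpret unit_conjugacy \<psi> T S
    using conj maps by unfold_locales
  have "continuous_on (\<psi> ` {0..1}) g"
    unfolding g_def using \<psi>(1) inj by (intro continuous_on_inv_into) auto
  moreover have g_unit: "g y \<in> {0..1}" if "y \<in> {0..1}" for y
  proof -
    have "y \<in> \<psi> ` {0..1}" using that onto by simp
    then show ?thesis using g by auto
  qed
  ultimately have S_cont: "continuous_on {0..1} S"
    unfolding S_def onto using maps_unit
    by (intro continuous_on_compose2[OF \<psi>(1)] continuous_on_compose2[OF cont]) auto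
  have "constant_slope lam S"
    unfolding constant_slope_def
  proof (rule countable_subset)
    \<comment> \<open>Exceptional points: images of end points of partition elements and of residual
      points. In the interior of the image of an element, \<open>S\<close> is affine with slope
      \<open>lam\<close> or \<open>- lam\<close>.\<close>
    show "countable (\<psi> ` (({0..1} - \<Union>Q) \<union> (\<Union>i\<in>Q. {Inf i, Sup i})))"
      using interval_tilingD[OF tiling] by auto
    show "{x \<in> {0..1}. \<not> (\<exists>D. (S has_real_derivative D) (at x within {0..1}) \<and> \<bar>D\<bar> = lam)}
      \<subseteq> \<psi> ` (({0..1} - \<Union>Q) \<union> (\<Union>i\<in>Q. {Inf i, Sup i}))" (is "_ \<subseteq> ?E")
    proof
      fix y assume y: "y \<in> {x \<in> {0..1}. \<not> (\<exists>D. (S has_real_derivative D) (at x within {0..1}) \<and> \<bar>D\<bar> = lam)}"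
      then have "y \<in> \<psi> ` {0..1}" using onto by simp
      then obtain x where x: "x \<in> {0..1}" "y = \<psi> x" by blast
      show "y \<in> ?E"
      proof (cases "x \<in> \<Union>Q")
        case True
        then obtain i where i: "i \<in> Q" "x \<in> i" by blast
        obtain a b where ab: "a < b" "i = {a..b}" "0 \<le> a" "b \<le> 1"
          using tiling i(1) by (rule interval_tiling_Icc)
        define D where "D = (if mono_on i T then lam else - lam)"
        have "\<not> (a < x \<and> x < b)"
        proof
          assume axb: "a < x \<and> x < b"
          have affine: "S y + D * (z - y) = S z" if "z \<in> {\<psi> a<..<\<psi> b}" for z
          proof -
            have "z \<in> \<psi> ` {a..b}" using that image_Icc[of a b] ab by auto
            then obtain w where w: "w \<in> i" "z = \<psi> w" using ab(2) by blast
            have "w \<in> {0..1}" using w ab by auto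
            then show ?thesis
              using \<psi>_increment[OF i(1,2) w(1)] x w(2) by (simp add: S_def g D_def)
          qed
          have y_in: "y \<in> {\<psi> a<..<\<psi> b}"
            using axb ab x \<psi>_less[of a x] \<psi>_less[of x b] by auto
          have "((\<lambda>z. S y + D * (z - y)) has_real_derivative D) (at y)"
            by (rule derivative_eq_intros refl | simp)+
          then have "(S has_real_derivative D) (at y)"
            by (rule has_field_derivative_transform_within_open[OF _ open_greaterThanLessThan y_in affine])
          then have "(S has_real_derivative D) (at y within {0..1})"
            by (rule has_field_derivative_at_within)
          moreover have "\<bar>D\<bar> = lam" using \<open>lam > 1\<close> by (simp add: D_def)
          ultimately show False using y by blast
        qed
        then have "x \<in> {Inf i, Sup i}" using i(2) ab by auto
        then show ?thesis using i(1) x(2) by blast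
      qed (use x in blast)
    qed
  qed
  then have "S \<in> CPMM_slope lam"
    using CPMM_image[OF T conj S_cont] by (simp add: CPMM_slope_def)
  then show ?thesis
    using conj by blast
qed

theorem theorem3:
  fixes T :: "real \<Rightarrow> real" and lam :: real
  assumes "T \<in> CPMM" and "lam > 1"
  shows
    "((\<exists>\<psi>. \<exists>S\<in>CPMM_slope lam. conjugate_via \<psi> T S) \<longleftrightarrow>
      (\<exists>P. classical_markov_partition T P \<and>
         (\<exists>u. positive_summable_solution P (transition_matrix T) lam u)))
     \<and>
     ((\<exists>P. classical_markov_partition T P \<and>
         (\<exists>u. positive_summable_solution P (transition_matrix T) lam u)) \<longleftrightarrow>
      (\<forall>P. classical_markov_partition T P \<longrightarrow>
         (\<exists>u. positive_summable_solution P (transition_matrix T) lam u)))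
     \<and>
     ((\<forall>P. classical_markov_partition T P \<longrightarrow>
         (\<exists>u. positive_summable_solution P (transition_matrix T) lam u)) \<longleftrightarrow>
      (\<forall>Q. slack_markov_partition T Q \<longrightarrow>
         (\<exists>v. positive_summable_solution Q (transition_matrix T) lam v)))
     \<and>
     ((\<forall>Q. slack_markov_partition T Q \<longrightarrow>
         (\<exists>v. positive_summable_solution Q (transition_matrix T) lam v)) \<longleftrightarrow>
      (\<exists>Q. slack_markov_partition T Q \<and>
         (\<exists>v. positive_summable_solution Q (transition_matrix T) lam v)))"
proof -
  let ?sol = "\<lambda>P. \<exists>u. positive_summable_solution P (transition_matrix T) lam u"
  let ?i = "\<exists>\<psi>. \<exists>S\<in>CPMM_slope lam. conjugate_via \<psi> T S"
  \<comment> \<open>The five conditions reduce to two implications: (i) gives (iv), and (v) gives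
    (i). Classical partitions are slack, so (ii) and (iii) lie in between.\<close>
  have i_iv: "?sol Q" if "?i" "slack_markov_partition T Q" for Q
  proof -
    interpret slack_partition T Q
      using assms(1) that(2) by (rule CPMM_slack_partition)
    show ?thesis
      using that(1) conjugate_imp_solution assms(2) by fastforce
  qed
  have v_i: "?i" if Q: "slack_markov_partition T Q" "?sol Q" for Q
  proof -
    interpret slack_partition T Q
      using assms(1) Q(1) by (rule CPMM_slack_partition)
    interpret R: slack_partition T refinement
      by (rule refinement_slack_partition)
    obtain u where "positive_summable_solution refinement (transition_matrix T) lam u"
      using refinement_solution Q(2) assms(2) by fastforce
    then show ?thesis
      by (rule R.solution_imp_conjugate[OF assms(1) refinement_classical assms(2)])
  qed
  \<comment> \<open>Existence of a partition keeps the universal conditions from being vacuous, so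
    that each implies its existential counterpart.\<close>
  obtain P where P: "classical_markov_partition T P"
    using CPMM_infinite_classical[OF assms(1)] by blast
  show ?thesis
    using i_iv v_i P classical_imp_slack by meson
qed

end
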